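(* Let $\mathcal{X}$ and $\mathcal{Y}$ be real separable Hilbert spaces, let $A:\mathcal{X}\to\mathcal{Y}$ be a bounded linear operator, and let $X$ be an $R$-subgaussian random vector in $\mathcal{X}$, where $R:\mathcal{X}\to\mathcal{X}$ is a positive self-adjoint trace class operator. Let $B := A R A^*:\mathcal{Y}\to\mathcal{Y}$, which is trace class. Then $$\mathbb{P}\left[ \|AX\|_{\mathcal{Y}}^2 > \operatorname{tr}(B) + 2\sqrt{t}\, \|B\|_{S_2(\mathcal{Y})} + 2t \|B\| \right] \leq e^{-t}\quad\text{for all } t \geq 0.$$
   Context: Random vectors in a Hilbert space are measurable functions (in the Bochner sense) from a probability space $(\Omega,\mathcal{F},\mathbb{P})$ to the space with its Borel $\sigma$-field. Let $R:\mathcal{X}\to\mathcal{X}$ be a positive self-adjoint trace class operator (positive means $\langle u, Ru\rangle_{\mathcal{X}}\ge 0$ for all $u$). An integrable centered ($\mathbb{E}[X]=0$) random vector $X$ in $\mathcal{X}$ is called $R$-subgaussian if $\log \mathbb{E}[e^{\langle u, X\rangle_{\mathcal{X}}}] \leq \frac{1}{2}\langle u, Ru\rangle_{\mathcal{X}}$ for all $u \in \mathcal{X}$. Here $\|B\|$ denotes the operator norm, $\|B\|_{S_2(\mathcal{Y})}$ the Hilbert--Schmidt norm, and $\operatorname{tr}$ the trace; $A^*$ is the adjoint of $A$. *)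

theory Defs
  imports "HOL-Probability.Probability"
begin

definition is_onb :: "'a::real_inner set \<Rightarrow> bool" where
  "is_onb E \<longleftrightarrow>
     pairwise orthogonal E \<and> (\<forall>e\<in>E. norm e = 1) \<and> closure (span E) = UNIV"

definition self_adjoint_op :: "('a::real_inner \<Rightarrow> 'a) \<Rightarrow> bool" where
  "self_adjoint_op T \<longleftrightarrow> (\<forall>x y. T x \<bullet> y = x \<bullet> T y)"

definition positive_op :: "('a::real_inner \<Rightarrow> 'a) \<Rightarrow> bool" where
  "positive_op T \<longleftrightarrow> (\<forall>u. u \<bullet> T u \<ge> 0)"

(* P is the absolute value |T|, the positive self-adjoint square root of T* T.
   On a Hilbert space it exists and is unique for every bounded T. *)
definition is_abs_op :: "('a::real_inner \<Rightarrow> 'a) \<Rightarrow> ('a \<Rightarrow> 'a) \<Rightarrow> bool" where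
  "is_abs_op T P \<longleftrightarrow>
     bounded_linear P \<and> self_adjoint_op P \<and> positive_op P \<and> P \<circ> P = adjoint T \<circ> T"

(* The trace of |T| is finite.  As |T| is positive, summability over one orthonormal
   basis is equivalent to summability over every orthonormal basis. *)
definition trace_class :: "('a::real_inner \<Rightarrow> 'a) \<Rightarrow> bool" where
  "trace_class T \<longleftrightarrow>
     bounded_linear T \<and>
     (\<exists>P E. is_abs_op T P \<and> is_onb E \<and> (\<lambda>e. e \<bullet> P e) summable_on E)"

(* For trace class (respectively Hilbert-Schmidt) T the next two values do not depend
   on the orthonormal basis that is chosen; infsum returns 0 on divergent sums, so they
   are meaningful only for such T. *)
definition trace_op :: "('a::real_inner \<Rightarrow> 'a) \<Rightarrow> real" where
  "trace_op T = (\<Sum>\<^sub>\<infinity>e\<in>(SOME E. is_onb E). e \<bullet> T e)"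

definition hs_norm :: "('a::real_inner \<Rightarrow> 'a) \<Rightarrow> real" where
  "hs_norm T = sqrt (\<Sum>\<^sub>\<infinity>e\<in>(SOME E. is_onb E). (norm (T e))\<^sup>2)"

(* The Bochner integral is 0 on functions that are not integrable; integrability of the
   exponential is therefore required explicitly.  It expresses that the logarithm of the
   (a priori possibly infinite) expectation is finite, as the upper bound demands. *)
definition subgaussian ::
  "'w measure \<Rightarrow> ('a::{real_inner, banach, second_countable_topology} \<Rightarrow> 'a)
    \<Rightarrow> ('w \<Rightarrow> 'a) \<Rightarrow> bool" where
  "subgaussian M R X \<longleftrightarrow>
     X \<in> borel_measurable M \<and> integrable M X \<and> (\<integral>\<omega>. X \<omega> \<partial>M) = 0 \<and>
     (\<forall>u. integrable M (\<lambda>\<omega>. exp (u \<bullet> X \<omega>)) \<and>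
          ln (\<integral>\<omega>. exp (u \<bullet> X \<omega>) \<partial>M) \<le> (1 / 2) * (u \<bullet> R u))"

end

theory Submission
  imports Defs
begin

text \<open>For a standard Gaussian vector \<open>\<gamma>\<close> independent of \<open>X\<close>,
  \<open>exp (l * (norm Z)\<^sup>2)\<close> is the conditional expectation of \<open>exp (sqrt (2 * l) * (\<gamma> \<bullet> Z))\<close>, so that for
  a finite-dimensional projection \<open>Z\<close> of \<open>A X\<close> the subgaussian hypothesis bounds its expectation by the
  one of \<open>exp (l * (\<gamma> \<bullet> B \<gamma>))\<close>, a product of Gaussian integrals once the compression of \<open>B\<close> is
  diagonalised. Compressions do not increase trace, Hilbert--Schmidt norm or operator norm, and Chernoff's
  inequality gives the tail bound for every projection; the projected norms increase to \<open>norm (A X)\<close>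
  along an orthonormal basis.\<close>

section \<open>Hilbert space preliminaries\<close>

text \<open>No infinite-dimensional spectral theorem enters, so traces over different bases, and
  even over different spaces, have to be compared by hand. \<open>trace_class R\<close> speaks of
  some positive root P of \<open>adjoint R o R\<close> and of some basis, while
  \<open>trace_op B\<close> sums over one chosen basis of the target space. Uniqueness of positive
  roots gives P = R. One inequality, \<open>positive_op_sum_le_trace\<close>, does the remaining
  comparisons: for the vectors \<open>adjoint A g\<close> it yields summability for B, and for
  orthonormal vectors it bounds the compressions of B and of \<open>B o B\<close>.

  The constants come from the Chernoff exponent. With b = \<open>onorm B\<close> and h the
  Hilbert-Schmidt norm, the logarithm of the product of Gaussian integrals is at most l * tau + l^2
  * h^2 / (1 - 2 * l * b), and l = sqrt t / (h + 2 * b * sqrt t) makes the total exponent exactly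
  -t. This choice breaks down at h = 0, so h is enlarged by a slack that tends to 0 while the
  projections grow.\<close>

lemma quadratic_nonneg_imp_linear_coeff_zero:
  fixes a b :: real
  assumes "\<And>t. 0 \<le> a * t\<^sup>2 + b * t"
  shows "b = 0"
proof (rule ccontr)
  assume "b \<noteq> 0"
  \<comment> \<open>Any positive c > a works: at -b/c the quadratic has the value b^2 * (a - c) /
    c^2 < 0. The absolute value avoids a case split on the sign of a.\<close>
  define c where "c = \<bar>a\<bar> + 1"
  have c: "c > 0" "a < c" by (auto simp: c_def)
  have "0 \<le> a * (- b / c)\<^sup>2 + b * (- b / c)" by (rule assms)
  also have "\<dots> = b\<^sup>2 * (a - c) / c\<^sup>2"
    using c by (simp add: field_simps power2_eq_square)
  also have "\<dots> < 0"
    using c \<open>b \<noteq> 0\<close> by (intro divide_neg_pos mult_pos_neg) auto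
  finally show False by simp
qed

text \<open>By the parallelogram law a minimising sequence for the distance is Cauchy: midpoints
  stay in S and cannot be closer than d. Orthogonality is the first-order condition at the nearest
  point.\<close>

lemma orthogonal_projection_exists:
  fixes S :: "'a::{real_inner, banach} set"
  assumes "subspace S" "closed S"
  obtains y where "y \<in> S" "\<And>z. z \<in> S \<Longrightarrow> (x - y) \<bullet> z = 0"
proof -
  define d where "d = infdist x S"
  have S: "S \<noteq> {}" using assms subspace_0 by blast
  have d0: "d \<ge> 0" by (simp add: d_def infdist_nonneg)
  have dle: "d\<^sup>2 \<le> (norm (x - z))\<^sup>2" if "z \<in> S" for z
    using infdist_le[OF that, of x] d0 unfolding d_def dist_norm by (intro power_mono) auto
  have "\<exists>y\<in>S. (norm (x - y))\<^sup>2 < d\<^sup>2 + 1 / real (Suc n)" for n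
  proof -
    have "d < sqrt (d\<^sup>2 + 1 / real (Suc n))"
      using d0 by (intro real_less_rsqrt) auto
    then obtain y where "y \<in> S" "dist x y < sqrt (d\<^sup>2 + 1 / real (Suc n))"
      using S cINF_less_iff[of S "dist x"] by (auto simp: d_def infdist_notempty)
    then have "(dist x y)\<^sup>2 < (sqrt (d\<^sup>2 + 1 / real (Suc n)))\<^sup>2"
      by (intro power_strict_mono) auto
    then show ?thesis
      using \<open>y \<in> S\<close> by (auto simp: dist_norm add_nonneg_nonneg intro!: bexI[of _ y])
  qed
  then obtain y where yS: "\<And>n. y n \<in> S"
    and y: "\<And>n. (norm (x - y n))\<^sup>2 < d\<^sup>2 + 1 / real (Suc n)"
    by metis
  have diff: "(norm (y m - y n))\<^sup>2 \<le> 2 / real (Suc m) + 2 / real (Suc n)" for m n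
  proof -
    have "(norm (y m - y n))\<^sup>2 =
        2 * (norm (x - y m))\<^sup>2 + 2 * (norm (x - y n))\<^sup>2 - 4 * (norm (x - (1/2) *\<^sub>R (y m + y n)))\<^sup>2"
      by (simp add: power2_norm_eq_inner algebra_simps inner_commute)
    moreover have "(1/2) *\<^sub>R (y m + y n) \<in> S"
      using yS assms by (intro subspace_scale subspace_add)
    ultimately show ?thesis
      using y[of m] y[of n] dle by (smt (verit) add_divide_distrib)
  qed
  have "Cauchy y"
  proof (rule metric_CauchyI)
    fix e :: real assume e: "e > 0"
    obtain N where N: "4 / e\<^sup>2 < real N" using reals_Archimedean2 by blast
    show "\<exists>M. \<forall>m\<ge>M. \<forall>n\<ge>M. dist (y m) (y n) < e"
    proof (intro exI allI impI)
      fix m n assume mn: "m \<ge> N" "n \<ge> N"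
      have "2 / real (Suc k) < e\<^sup>2 / 2" if "k \<ge> N" for k
      proof -
        have "4 / e\<^sup>2 < real (Suc k)" using N that by linarith
        then show ?thesis using e by (simp add: field_simps)
      qed
      then have "(norm (y m - y n))\<^sup>2 < e\<^sup>2"
        using diff[of m n] mn by (smt (verit) field_sum_of_halves)
      then show "dist (y m) (y n) < e"
        using e by (simp add: dist_norm power2_less_imp_less)
    qed
  qed
  then obtain l where l: "y \<longlonglongrightarrow> l" by (auto simp: Cauchy_convergent_iff convergent_def)
  have lS: "l \<in> S" using l yS assms by (auto intro: closed_sequentially)
  have "(norm (x - l))\<^sup>2 \<le> d\<^sup>2"
  proof (rule LIMSEQ_le)
    show "(\<lambda>n. (norm (x - y n))\<^sup>2) \<longlonglongrightarrow> (norm (x - l))\<^sup>2" by (intro tendsto_intros l)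
    show "(\<lambda>n. d\<^sup>2 + 1 / real (Suc n)) \<longlonglongrightarrow> d\<^sup>2"
      using tendsto_add[OF tendsto_const LIMSEQ_inverse_real_of_nat, of "d\<^sup>2"]
      by (simp add: inverse_eq_divide)
  qed (use y less_imp_le in blast)
  then have min: "(norm (x - l))\<^sup>2 \<le> (norm (x - z))\<^sup>2" if "z \<in> S" for z
    using dle[OF that] by (rule order_trans)
  have "(x - l) \<bullet> z = 0" if z: "z \<in> S" for z
  proof -
    have "0 \<le> (z \<bullet> z) * t\<^sup>2 + (-2 * ((x - l) \<bullet> z)) * t" for t
    proof -
      have "l + t *\<^sub>R z \<in> S" using z lS assms by (intro subspace_add subspace_scale)
      from min[OF this] show ?thesis
        unfolding power2_norm_eq_inner
        by (simp add: algebra_simps inner_commute power2_eq_square)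
    qed
    from quadratic_nonneg_imp_linear_coeff_zero[OF this] show ?thesis by simp
  qed
  with lS that show thesis by blast
qed

text \<open>The kernel of a nonzero f is a closed hyperplane. The residual w of projecting a vector
  outside it is a normal vector, and rescaling w gives the representer.\<close>

lemma Riesz_representation:
  fixes f :: "'a::{real_inner, banach} \<Rightarrow> real"
  assumes "bounded_linear f"
  obtains v where "\<And>x. f x = x \<bullet> v"
proof (cases "\<forall>x. f x = 0")
  case True
  show ?thesis by (rule that[of 0]) (simp add: True)
next
  case False
  interpret bounded_linear f by fact
  from False obtain x where x: "f x \<noteq> 0" by blast
  let ?S = "{x. f x = 0}"
  have sub: "subspace ?S" by (auto simp: subspace_def add scaleR zero)
  have cl: "closed ?S"
    using closed_Collect_eq[OF linear_continuous_on[OF assms, of UNIV] continuous_on_const] by simp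
  obtain y where y: "f y = 0" "\<And>z. f z = 0 \<Longrightarrow> (x - y) \<bullet> z = 0"
    by (rule orthogonal_projection_exists[OF sub cl, of x]) auto
  define w where "w = x - y"
  have fw: "f w = f x" by (simp add: w_def diff y)
  then have w: "w \<noteq> 0" using x zero by auto
  have "f z = z \<bullet> ((f w / (w \<bullet> w)) *\<^sub>R w)" for z
  proof -
    have "f (z - (f z / f w) *\<^sub>R w) = 0" using fw x by (simp add: diff scaleR)
    then have "w \<bullet> (z - (f z / f w) *\<^sub>R w) = 0" using y(2) w_def by blast
    then have "w \<bullet> z = f z / f w * (w \<bullet> w)" by (simp add: inner_diff_right)
    then show ?thesis using w fw x by (simp add: field_simps inner_commute)
  qed
  then show ?thesis by (rule that)
qed

text \<open>\<open>adjoint\<close> is a choice among maps with this identity, so the identity is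
  available only once such a map is known to exist; Riesz representation supplies its
  values.\<close>

lemma adjoint_inner:
  fixes f :: "'a::{real_inner, banach} \<Rightarrow> 'b::real_inner"
  assumes "bounded_linear f"
  shows "x \<bullet> adjoint f y = f x \<bullet> y"
proof -
  have "\<exists>w. \<forall>x. f x \<bullet> y = x \<bullet> w" for y
    using Riesz_representation[OF bounded_linear_compose[OF bounded_linear_inner_left assms]]
    by metis
  then have "\<exists>g. \<forall>x y. f x \<bullet> y = x \<bullet> g y" by metis
  from someI_ex[OF this, THEN spec, THEN spec, of x y] show ?thesis
    unfolding adjoint_def by (rule sym)
qed

lemma bounded_linear_adjoint:
  fixes f :: "'a::{real_inner, banach} \<Rightarrow> 'b::real_inner"
  assumes "bounded_linear f"
  shows "bounded_linear (adjoint f)"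
proof (rule bounded_linear_intro)
  \<comment> \<open>Linearity is checked weakly: the difference of the two sides has inner product 0
    with itself.\<close>
  show "adjoint f (x + y) = adjoint f x + adjoint f y" for x y
    by (rule inner_eq_zero_iff[THEN iffD1, THEN eq_iff_diff_eq_0[THEN iffD2]])
       (simp add: inner_diff_left inner_diff_right inner_add_right inner_add_left
          adjoint_inner[OF assms] inner_commute[of "adjoint f _"])
  show "adjoint f (r *\<^sub>R x) = r *\<^sub>R adjoint f x" for r x
    by (rule inner_eq_zero_iff[THEN iffD1, THEN eq_iff_diff_eq_0[THEN iffD2]])
       (simp add: inner_diff_left inner_diff_right adjoint_inner[OF assms] inner_commute[of "adjoint f _"])
  show "norm (adjoint f x) \<le> norm x * onorm f" for x
  proof (cases "adjoint f x = 0")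
    case False
    have "norm (adjoint f x) * norm (adjoint f x) = f (adjoint f x) \<bullet> x"
      by (metis adjoint_inner assms power2_eq_square power2_norm_eq_inner)
    also have "\<dots> \<le> norm (f (adjoint f x)) * norm x" by (rule norm_cauchy_schwarz)
    also have "\<dots> \<le> onorm f * norm (adjoint f x) * norm x"
      by (intro mult_right_mono onorm assms) auto
    finally show ?thesis using False by (simp add: mult.commute mult.left_commute)
  qed (simp add: onorm_pos_le assms)
qed

section \<open>Orthonormal systems, bases and Parseval's identity\<close>

definition orthonormal :: "'a::real_inner set \<Rightarrow> bool" where
  "orthonormal E \<longleftrightarrow> pairwise orthogonal E \<and> (\<forall>e\<in>E. norm e = 1)"

lemma orthonormal_inner:
  "orthonormal E \<Longrightarrow> e \<in> E \<Longrightarrow> f \<in> E \<Longrightarrow> e \<bullet> f = (if e = f then 1 else 0)"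
  by (auto simp: orthonormal_def pairwise_def orthogonal_def simp flip: norm_eq_1)

lemma orthonormal_subset: "orthonormal E \<Longrightarrow> F \<subseteq> E \<Longrightarrow> orthonormal F"
  unfolding orthonormal_def by (meson pairwise_subset subset_iff)

lemma subspace_closure:
  fixes S :: "'a::real_normed_vector set"
  assumes "subspace S"
  shows "subspace (closure S)"
  unfolding subspace_def
proof (intro conjI ballI allI)
  show "0 \<in> closure S" using assms closure_subset subspace_0 by blast
  show "x + y \<in> closure S" if xy: "x \<in> closure S" "y \<in> closure S" for x y
  proof -
    obtain u v where uv: "\<forall>n. u n \<in> S" "u \<longlonglongrightarrow> x" "\<forall>n. v n \<in> S" "v \<longlonglongrightarrow> y"
      using xy unfolding closure_sequential by blast
    show ?thesis unfolding closure_sequential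
      by (rule exI[of _ "\<lambda>n. u n + v n"]) (use uv assms in \<open>auto intro: tendsto_add subspace_add\<close>)
  qed
  show "c *\<^sub>R x \<in> closure S" if "x \<in> closure S" for c x
  proof -
    obtain u where u: "\<forall>n. u n \<in> S" "u \<longlonglongrightarrow> x"
      using \<open>x \<in> closure S\<close> unfolding closure_sequential by blast
    show ?thesis unfolding closure_sequential
      by (rule exI[of _ "\<lambda>n. c *\<^sub>R u n"]) (use u assms in \<open>auto intro: tendsto_scaleR subspace_scale\<close>)
  qed
qed

text \<open>This gives meaning to the \<open>SOME\<close> in \<open>trace_op\<close> and
  \<open>hs_norm\<close>. A maximal orthonormal set has dense span, since otherwise the normalised
  residual of a projection onto its closed span could be adjoined.\<close>

lemma ex_is_onb: "\<exists>E :: 'a::{real_inner, banach} set. is_onb E"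
proof -
  have "\<exists>E\<in>{E :: 'a set. orthonormal E}. \<forall>F\<in>{E. orthonormal E}. E \<subseteq> F \<longrightarrow> F = E"
  proof (rule subset_Zorn')
    fix C :: "'a set set" assume C: "subset.chain {E. orthonormal E} C"
    then have o: "\<And>E. E \<in> C \<Longrightarrow> orthonormal E"
      and c: "\<And>E F. E \<in> C \<Longrightarrow> F \<in> C \<Longrightarrow> E \<subseteq> F \<or> F \<subseteq> E"
      unfolding subset.chain_def by auto
    show "\<Union>C \<in> {E. orthonormal E}"
      unfolding mem_Collect_eq orthonormal_def
    proof
      show "pairwise orthogonal (\<Union>C)"
      proof (rule pairwiseI)
        fix x y assume xy: "x \<in> \<Union>C" "y \<in> \<Union>C" "x \<noteq> y"
        then obtain E where "E \<in> C" "x \<in> E" "y \<in> E" by (meson UnionE c subset_iff)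
        with xy o show "orthogonal x y" unfolding orthonormal_def pairwise_def by blast
      qed
      show "\<forall>e\<in>\<Union>C. norm e = 1" using o unfolding orthonormal_def by blast
    qed
  qed
  then obtain E :: "'a set" where E: "orthonormal E"
    and max: "\<And>F. orthonormal F \<Longrightarrow> E \<subseteq> F \<Longrightarrow> F = E" by blast
  have "x \<in> closure (span E)" for x
  proof -
    obtain y where y: "y \<in> closure (span E)" "\<And>z. z \<in> closure (span E) \<Longrightarrow> (x - y) \<bullet> z = 0"
      using orthogonal_projection_exists[of "closure (span E)" x, OF subspace_closure[OF subspace_span] closed_closure]
      by blast
    have orth: "(x - y) \<bullet> e = 0" if "e \<in> E" for e
      using y(2) that by (meson closure_subset span_base subset_iff)
    have "x = y"
    proof (rule ccontr)
      assume "x \<noteq> y"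
      define w where "w = (x - y) /\<^sub>R norm (x - y)"
      have w: "norm w = 1" "\<And>e. e \<in> E \<Longrightarrow> w \<bullet> e = 0"
        using \<open>x \<noteq> y\<close> orth by (auto simp: w_def)
      have "orthonormal (insert w E)"
        using E w unfolding orthonormal_def pairwise_insert
        by (auto simp: orthogonal_def inner_commute)
      from max[OF this] have "w \<in> E" by blast
      from w(2)[OF this] w(1) show False by auto
    qed
    with y show ?thesis by simp
  qed
  then have "is_onb E" using E unfolding is_onb_def orthonormal_def by auto
  then show ?thesis ..
qed

lemma is_onb_orthonormal: "is_onb E \<Longrightarrow> orthonormal E"
  by (simp add: is_onb_def orthonormal_def)

text \<open>Distinct members lie at distance sqrt 2, so the balls of radius 1/2 around them are
  disjoint open sets. Countability later allows exhausting a basis by a sequence of finite sets, as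
  continuity of the measure demands.\<close>

lemma orthonormal_countable:
  fixes E :: "'a::{real_inner, second_countable_topology} set"
  assumes "orthonormal E"
  shows "countable E"
proof -
  have sep: "e = f" if "e \<in> E" "f \<in> E" "z \<in> ball e (1/2)" "z \<in> ball f (1/2)" for e f z
  proof (rule ccontr)
    assume "e \<noteq> f"
    have "dist e f < 1"
      using that dist_triangle_half_l[of e z 1 f] by (simp add: dist_commute)
    then have "(norm (e - f))\<^sup>2 < 1" by (simp add: dist_norm power_less_one_iff abs_square_less_1)
    moreover have "(norm (e - f))\<^sup>2 = 2"
      using orthonormal_inner[OF assms] that \<open>e \<noteq> f\<close>
      by (simp add: power2_norm_eq_inner inner_diff_left inner_diff_right)
    ultimately show False by simp
  qed
  have "countable ((\<lambda>e. ball e (1/2)) ` E)"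
    by (rule countable_disjoint_open_subsets)
       (auto simp: pairwise_def disjnt_def dest: sep)
  moreover have "inj_on (\<lambda>e. ball e (1/2 :: real)) E"
  proof (rule inj_onI)
    fix e f assume ef: "e \<in> E" "f \<in> E" "ball e (1/2 :: real) = ball f (1/2)"
    have "e \<in> ball e (1/2)" by simp
    then have "e \<in> ball f (1/2)" using ef(3) by blast
    then show "e = f" by (intro sep[OF ef(1,2), of e]) simp_all
  qed
  ultimately show ?thesis by (rule countable_image_inj_on)
qed

text \<open>Arbitrary coefficients c are allowed so that one identity serves three purposes: Bessel
  when c is the list of Fourier coefficients, finite Parseval when the left side vanishes, and best
  approximation because the last sum is nonnegative.\<close>

lemma norm_diff_orthonormal_sum:
  assumes "orthonormal F" "finite F"
  shows "(norm (x - (\<Sum>f\<in>F. c f *\<^sub>R f)))\<^sup>2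
    = (norm x)\<^sup>2 - (\<Sum>f\<in>F. (x \<bullet> f)\<^sup>2) + (\<Sum>f\<in>F. (x \<bullet> f - c f)\<^sup>2)"
proof -
  have "(\<Sum>f\<in>F. c f *\<^sub>R f) \<bullet> (\<Sum>f\<in>F. c f *\<^sub>R f) = (\<Sum>f\<in>F. \<Sum>g\<in>F. c f * c g * (f \<bullet> g))"
    unfolding inner_sum_left unfolding inner_sum_right by (simp add: mult.assoc mult.left_commute inner_commute)
  also have "\<dots> = (\<Sum>f\<in>F. \<Sum>g\<in>F. if g = f then c f * c g else 0)"
    by (intro sum.cong refl) (use orthonormal_inner[OF assms(1)] in auto)
  also have "\<dots> = (\<Sum>f\<in>F. (c f)\<^sup>2)"
    using assms(2) by (simp add: power2_eq_square)
  finally have 1: "(\<Sum>f\<in>F. c f *\<^sub>R f) \<bullet> (\<Sum>f\<in>F. c f *\<^sub>R f) = (\<Sum>f\<in>F. (c f)\<^sup>2)" .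
  have "(norm (x - (\<Sum>f\<in>F. c f *\<^sub>R f)))\<^sup>2
      = (norm x)\<^sup>2 - 2 * (x \<bullet> (\<Sum>f\<in>F. c f *\<^sub>R f)) + (\<Sum>f\<in>F. c f *\<^sub>R f) \<bullet> (\<Sum>f\<in>F. c f *\<^sub>R f)"
    by (simp add: power2_norm_eq_inner inner_diff_left inner_diff_right inner_commute)
  then show ?thesis
    unfolding 1
    by (simp add: inner_sum_right power2_diff sum.distrib sum_subtractf sum_distrib_left algebra_simps)
qed

lemma orthonormal_Bessel:
  assumes "orthonormal F" "finite F"
  shows "(\<Sum>f\<in>F. (x \<bullet> f)\<^sup>2) \<le> (norm x)\<^sup>2"
proof -
  have "0 \<le> (norm (x - (\<Sum>f\<in>F. (x \<bullet> f) *\<^sub>R f)))\<^sup>2" by simp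
  also have "\<dots> = (norm x)\<^sup>2 - (\<Sum>f\<in>F. (x \<bullet> f)\<^sup>2)"
    unfolding norm_diff_orthonormal_sum[OF assms] by simp
  finally show ?thesis by simp
qed

lemma orthonormal_Parseval_finite:
  assumes "orthonormal F" "finite F" "x \<in> span F"
  shows "(\<Sum>f\<in>F. (x \<bullet> f) *\<^sub>R f) = x" "(\<Sum>f\<in>F. (x \<bullet> f)\<^sup>2) = (norm x)\<^sup>2"
proof -
  obtain c where c: "x = (\<Sum>f\<in>F. c f *\<^sub>R f)" using assms span_finite[of F] by auto
  have "(norm x)\<^sup>2 - (\<Sum>f\<in>F. (x \<bullet> f)\<^sup>2) + (\<Sum>f\<in>F. (x \<bullet> f - c f)\<^sup>2) = 0"
    using norm_diff_orthonormal_sum[OF assms(1,2), of x c] c by simp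
  moreover have "(\<Sum>f\<in>F. (x \<bullet> f - c f)\<^sup>2) \<ge> 0" by (intro sum_nonneg) auto
  ultimately show *: "(\<Sum>f\<in>F. (x \<bullet> f)\<^sup>2) = (norm x)\<^sup>2"
    using orthonormal_Bessel[OF assms(1,2), of x] by linarith
  show "(\<Sum>f\<in>F. (x \<bullet> f) *\<^sub>R f) = x"
    using norm_diff_orthonormal_sum[OF assms(1,2), of x "\<lambda>f. x \<bullet> f"] * by simp
qed

lemma is_onb_Parseval:
  fixes E :: "'a::real_inner set"
  assumes "is_onb E"
  shows "((\<lambda>e. (x \<bullet> e)\<^sup>2) has_sum (norm x)\<^sup>2) E"
proof -
  note E = is_onb_orthonormal[OF assms]
  have "(\<Sum>f\<in>F. (x \<bullet> f)\<^sup>2) \<le> (norm x)\<^sup>2" if "finite F" "F \<subseteq> E" for F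
    using orthonormal_Bessel orthonormal_subset[OF E] that by blast
  then have s: "(\<lambda>e. (x \<bullet> e)\<^sup>2) summable_on E"
    by (intro nonneg_bdd_above_summable_on bdd_aboveI2[of _ _ "(norm x)\<^sup>2"]) auto
  have "infsum (\<lambda>e. (x \<bullet> e)\<^sup>2) E \<le> (norm x)\<^sup>2"
    by (rule infsum_le_finite_sums[OF s]) fact
  moreover have "(norm x)\<^sup>2 \<le> infsum (\<lambda>e. (x \<bullet> e)\<^sup>2) E"
  proof (rule field_le_epsilon)
    fix \<epsilon> :: real assume \<epsilon>: "\<epsilon> > 0"
    have "x \<in> closure (span E)" using assms by (simp add: is_onb_def)
    then obtain z where z: "z \<in> span E" "dist z x < sqrt \<epsilon>"
      using \<epsilon> closure_approachable[of x "span E"] real_sqrt_gt_zero by blast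
    then obtain F c where F: "finite F" "F \<subseteq> E" "z = (\<Sum>f\<in>F. c f *\<^sub>R f)"
      unfolding span_explicit by blast
    \<comment> \<open>The Bessel defect over F is the squared distance to the best approximation,
      hence at most the squared distance to z.\<close>
    have "(norm x)\<^sup>2 - (\<Sum>f\<in>F. (x \<bullet> f)\<^sup>2) \<le> (norm (x - z))\<^sup>2"
      unfolding F(3) norm_diff_orthonormal_sum[OF orthonormal_subset[OF E F(2)] F(1)]
      by (simp add: sum_nonneg)
    also have "\<dots> \<le> (sqrt \<epsilon>)\<^sup>2"
      using z(2) by (intro power_mono) (auto simp: dist_norm norm_minus_commute)
    also have "\<dots> = \<epsilon>" using \<epsilon> by simp
    finally show "(norm x)\<^sup>2 \<le> infsum (\<lambda>e. (x \<bullet> e)\<^sup>2) E + \<epsilon>"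
      using finite_sum_le_infsum[OF s F(1,2)] by auto
  qed
  ultimately show ?thesis using has_sum_infsum[OF s] by simp
qed

section \<open>Positive operators and traces\<close>

lemma positive_op_Cauchy_Schwarz:
  assumes "bounded_linear R" "self_adjoint_op R" "positive_op R"
  shows "(x \<bullet> R y)\<^sup>2 \<le> (x \<bullet> R x) * (y \<bullet> R y)"
proof -
  interpret bounded_linear R by fact
  have sym: "y \<bullet> R x = x \<bullet> R y"
    using assms(2) by (metis self_adjoint_op_def inner_commute)
  have nn: "0 \<le> z \<bullet> R z" for z using assms(3) by (simp add: positive_op_def)
  have q: "0 \<le> x \<bullet> R x + 2 * t * (x \<bullet> R y) + t\<^sup>2 * (y \<bullet> R y)" for t
    using nn[of "x + t *\<^sub>R y"]
    by (simp add: add scaleR inner_add_left inner_add_right sym power2_eq_square algebra_simps)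
  show ?thesis
  proof (cases "y \<bullet> R y = 0")
    case True
    have "x \<bullet> R y = 0"
    proof (rule ccontr)
      assume b: "x \<bullet> R y \<noteq> 0"
      \<comment> \<open>In the degenerate case the quadratic in t is affine; this t gives it the
        value -1.\<close>
      show False using q[of "- (x \<bullet> R x + 1) / (2 * (x \<bullet> R y))"] b True by (simp add: field_simps)
    qed
    with True show ?thesis by simp
  next
    case False
    then have c: "y \<bullet> R y > 0" using nn[of y] by simp
    have "0 \<le> (y \<bullet> R y) * (x \<bullet> R x + 2 * (- (x \<bullet> R y) / (y \<bullet> R y)) * (x \<bullet> R y)
        + (- (x \<bullet> R y) / (y \<bullet> R y))\<^sup>2 * (y \<bullet> R y))"
      by (intro mult_nonneg_nonneg q nn)
    also have "\<dots> = (x \<bullet> R x) * (y \<bullet> R y) - (x \<bullet> R y)\<^sup>2"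
      using c by (simp add: field_simps power2_eq_square)
    finally show ?thesis by simp
  qed
qed

text \<open>Cauchy-Schwarz for the form of R, applied to x and \<open>R x\<close>. It lets a small
  quadratic form force a small image, and it bounds Hilbert-Schmidt sums by traces.\<close>

lemma positive_op_norm_le:
  assumes "bounded_linear R" "self_adjoint_op R" "positive_op R"
  shows "(norm (R x))\<^sup>2 \<le> onorm R * (x \<bullet> R x)"
proof (cases "R x = 0")
  case False
  have "(R x \<bullet> R x)\<^sup>2 = (x \<bullet> R (R x))\<^sup>2"
    using assms(2) by (simp add: self_adjoint_op_def)
  also have "\<dots> \<le> (x \<bullet> R x) * (R x \<bullet> R (R x))"
    by (rule positive_op_Cauchy_Schwarz[OF assms])
  also have "\<dots> \<le> (x \<bullet> R x) * (norm (R x) * (onorm R * norm (R x)))"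
  proof (rule mult_left_mono)
    have "R x \<bullet> R (R x) \<le> norm (R x) * norm (R (R x))" by (rule norm_cauchy_schwarz)
    also have "\<dots> \<le> norm (R x) * (onorm R * norm (R x))"
      by (intro mult_left_mono onorm assms) auto
    finally show "R x \<bullet> R (R x) \<le> norm (R x) * (onorm R * norm (R x))" .
  qed (use assms(3) in \<open>simp add: positive_op_def\<close>)
  also have "\<dots> = onorm R * (x \<bullet> R x) * (norm (R x))\<^sup>2"
    by (simp add: power2_eq_square)
  also have "(R x \<bullet> R x)\<^sup>2 = (norm (R x))\<^sup>2 * (norm (R x))\<^sup>2"
    by (simp only: power2_norm_eq_inner power2_eq_square[of "R x \<bullet> R x"])
  finally show ?thesis using False by (simp only: mult_le_cancel_right) simp
next
  case True
  then show ?thesis by simp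
qed

text \<open>With \<open>D = P - R\<close> one has \<open>P D = - D R\<close>, hence \<open>D\<^sup>2 R = - D P D \<le> 0\<close>. If \<open>N = onorm D > 0\<close>, then
  along unit vectors \<open>x\<close> with \<open>norm (D x)\<close> tending to \<open>N\<close> the vectors \<open>D\<^sup>2 x\<close> approach \<open>N\<^sup>2 x\<close>, so
  \<open>x \<bullet> R x\<close>, and likewise \<open>x \<bullet> P x\<close>, tends to \<open>0\<close>; by positivity so do \<open>R x\<close>, \<open>P x\<close> and \<open>D x\<close>.\<close>

lemma positive_op_unique:
  assumes P: "bounded_linear P" "self_adjoint_op P" "positive_op P"
    and R: "bounded_linear R" "self_adjoint_op R" "positive_op R"
    and eq: "\<And>x. P (P x) = R (R x)"
  shows "P = R"
proof -
  define D where "D = (\<lambda>x. P x - R x)"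
  define N where "N = onorm D"
  interpret P: bounded_linear P by fact
  interpret R: bounded_linear R by fact
  have D: "bounded_linear D" unfolding D_def by (intro bounded_linear_sub P R)
  interpret D: bounded_linear D by fact
  have D_sym: "D x \<bullet> y = x \<bullet> D y" for x y
    using P(2) R(2) by (simp add: D_def inner_diff_left inner_diff_right self_adjoint_op_def)
  \<comment> \<open>T is again positive, so \<open>positive_op_norm_le\<close> applies to it: where
    the form of T is small, T itself is small, which turns near-maximisers of
    \<open>norm (D x)\<close> into approximate eigenvectors of D^2.\<close>
  define T where "T = (\<lambda>x. N\<^sup>2 *\<^sub>R x - D (D x))"
  have T: "bounded_linear T"
    unfolding T_def
    by (intro bounded_linear_sub bounded_linear_scaleR_right bounded_linear_compose[OF D D])
  have xT: "x \<bullet> T x = N\<^sup>2 * (norm x)\<^sup>2 - (norm (D x))\<^sup>2" for x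
    by (simp add: T_def inner_diff_right power2_norm_eq_inner D_sym)
  have "self_adjoint_op T"
    by (simp add: self_adjoint_op_def T_def inner_diff_left inner_diff_right D_sym)
  moreover have "positive_op T"
    unfolding positive_op_def
  proof
    fix x
    have "(norm (D x))\<^sup>2 \<le> (N * norm x)\<^sup>2"
      unfolding N_def by (intro power_mono onorm D) auto
    then show "0 \<le> x \<bullet> T x" by (simp add: xT power_mult_distrib)
  qed
  ultimately have T_le: "(norm (T x))\<^sup>2 \<le> onorm T * (x \<bullet> T x)" for x
    by (rule positive_op_norm_le[OF T])
  have key: "N\<^sup>2 * (x \<bullet> R x) \<le> T x \<bullet> R x" "N\<^sup>2 * (x \<bullet> P x) \<le> T x \<bullet> P x" for x
  proof -
    have "P (D x) = - D (R x)" "R (D x) = - D (P x)"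
      by (simp_all add: D_def P.diff R.diff eq)
    then have "D x \<bullet> P (D x) = - (D (D x) \<bullet> R x)" "D x \<bullet> R (D x) = - (D (D x) \<bullet> P x)"
      by (simp_all add: D_sym)
    moreover have "0 \<le> D x \<bullet> P (D x)" "0 \<le> D x \<bullet> R (D x)"
      using P(3) R(3) by (auto simp: positive_op_def)
    ultimately show "N\<^sup>2 * (x \<bullet> R x) \<le> T x \<bullet> R x" "N\<^sup>2 * (x \<bullet> P x) \<le> T x \<bullet> P x"
      by (simp_all add: T_def inner_diff_left)
  qed
  have "N = 0"
  proof (rule ccontr)
    assume "N \<noteq> 0"
    then have N: "N > 0" unfolding N_def using onorm_pos_le[OF D] by linarith
    have "\<exists>x. norm x = 1 \<and> N * (1 - 1 / real (n + 2)) < norm (D x)" for n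
    proof -
      \<comment> \<open>Otherwise a constant strictly below N would bound D, contradicting N =
        \<open>onorm D\<close>.\<close>
      have "\<exists>x. \<not> norm (D x) \<le> N * (1 - 1 / real (n + 2)) * norm x"
      proof (rule ccontr)
        assume "\<not> ?thesis"
        then have "N \<le> N * (1 - 1 / real (n + 2))"
          unfolding N_def using N N_def by (intro onorm_bound) auto
        with N show False by (simp add: field_simps)
      qed
      then obtain x where x: "N * (1 - 1 / real (n + 2)) * norm x < norm (D x)"
        unfolding not_le by blast
      then have "x \<noteq> 0" by auto
      with x show ?thesis
        by (intro exI[of _ "x /\<^sub>R norm x"]) (simp add: D.scaleR field_simps)
    qed
    then obtain x where x: "\<And>n. norm (x n) = 1"
      and Dx: "\<And>n. N * (1 - 1 / real (n + 2)) < norm (D (x n))" by metis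
    have "(\<lambda>n. 1 / real (n + 2)) \<longlonglongrightarrow> 0"
      using LIMSEQ_ignore_initial_segment[OF LIMSEQ_inverse_real_of_nat, of 1]
      by (simp add: inverse_eq_divide add.commute)
    then have lower: "(\<lambda>n. N * (1 - 1 / real (n + 2))) \<longlonglongrightarrow> N * (1 - 0)"
      by (intro tendsto_intros)
    have lim_D: "(\<lambda>n. norm (D (x n))) \<longlonglongrightarrow> N"
    proof (rule tendsto_sandwich[OF _ _ lower[unfolded diff_zero mult_1_right] tendsto_const])
      show "\<forall>\<^sub>F n in sequentially. norm (D (x n)) \<le> N"
        using onorm[OF D, of "x _"] by (simp add: x N_def)
      show "\<forall>\<^sub>F n in sequentially. N * (1 - 1 / real (n + 2)) \<le> norm (D (x n))"
        by (intro always_eventually allI less_imp_le Dx)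
    qed
    have to_zero: "(\<lambda>n. f n) \<longlonglongrightarrow> (0 :: real)"
      if "\<And>n. (f n)\<^sup>2 \<le> c * g n" "g \<longlonglongrightarrow> 0" for f g c
    proof -
      have "(\<lambda>n. (f n)\<^sup>2) \<longlonglongrightarrow> 0"
        by (rule tendsto_sandwich[OF _ _ tendsto_const tendsto_mult_right_zero[OF that(2), of c]])
           (intro always_eventually allI zero_le_power2 that(1))+
      then show ?thesis by simp
    qed
    have "(\<lambda>n. x n \<bullet> T (x n)) \<longlonglongrightarrow> N\<^sup>2 * 1\<^sup>2 - N\<^sup>2"
      unfolding xT x by (intro tendsto_intros lim_D)
    then have lim_T: "(\<lambda>n. norm (T (x n))) \<longlonglongrightarrow> 0"
      using to_zero[of "\<lambda>n. norm (T (x n))", OF T_le] by simp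
    have lim_Q: "(\<lambda>n. norm (Q (x n))) \<longlonglongrightarrow> 0"
      if Q: "bounded_linear Q" "self_adjoint_op Q" "positive_op Q"
        and Qk: "\<And>x. N\<^sup>2 * (x \<bullet> Q x) \<le> T x \<bullet> Q x" for Q
    proof -
      have "N\<^sup>2 * (x n \<bullet> Q (x n)) \<le> norm (T (x n)) * onorm Q" for n
      proof -
        have "T (x n) \<bullet> Q (x n) \<le> norm (T (x n)) * norm (Q (x n))" by (rule norm_cauchy_schwarz)
        also have "\<dots> \<le> norm (T (x n)) * onorm Q"
          using onorm[OF Q(1), of "x n"] by (intro mult_left_mono) (auto simp: x)
        finally show ?thesis using Qk[of "x n"] by linarith
      qed
      then have up: "x n \<bullet> Q (x n) \<le> onorm Q / N\<^sup>2 * norm (T (x n))" for n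
        using N by (simp add: field_simps)
      have "(\<lambda>n. x n \<bullet> Q (x n)) \<longlonglongrightarrow> 0"
        by (rule tendsto_sandwich[OF _ _ tendsto_const tendsto_mult_right_zero[OF lim_T, of "onorm Q / N\<^sup>2"]])
           (intro always_eventually allI up Q(3)[unfolded positive_op_def, rule_format])+
      then show ?thesis
        by (rule to_zero[of "\<lambda>n. norm (Q (x n))", OF positive_op_norm_le[OF Q]])
    qed
    have "(\<lambda>n. norm (P (x n)) + norm (R (x n))) \<longlonglongrightarrow> 0 + 0"
      by (intro tendsto_add lim_Q P R key)
    then have "(\<lambda>n. norm (P (x n)) + norm (R (x n))) \<longlonglongrightarrow> 0" by simp
    then have "(\<lambda>n. norm (D (x n))) \<longlonglongrightarrow> 0"
      by (rule tendsto_sandwich[OF _ _ tendsto_const, rotated 2])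
         (auto simp: D_def intro!: always_eventually norm_triangle_ineq4)
    from LIMSEQ_unique[OF this lim_D] N show False by simp
  qed
  then have "D x = 0" for x using onorm_eq_0[OF D] by (simp add: N_def)
  then show ?thesis by (auto simp: D_def fun_eq_iff)
qed

text \<open>The trace class hypothesis only speaks of the sums of an absolute value P; this
  transfers them to R itself.\<close>

lemma is_abs_op_positive_eq:
  assumes "bounded_linear R" "self_adjoint_op R" "positive_op R" "is_abs_op R P"
  shows "P = R"
proof (rule positive_op_unique)
  have "adjoint R = R"
    using assms(2) by (intro adjoint_unique) (simp add: self_adjoint_op_def)
  then have "P \<circ> P = R \<circ> R" using assms(4) by (simp add: is_abs_op_def)
  then show "P (P x) = R (R x)" for x by (metis comp_apply)
qed (use assms in \<open>auto simp: is_abs_op_def\<close>)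

text \<open>Each step of the induction splits off the rank one part of \<open>R\<close> in the direction of one of
  the \<open>y i\<close>; the Schur complement that remains is again positive.  The bound on the part that is
  split off is Parseval's identity for \<open>E\<close>.\<close>

lemma positive_op_sum_le_trace:
  assumes "is_onb E"
    and "bounded_linear R" "self_adjoint_op R" "positive_op R"
    and "((\<lambda>e. e \<bullet> R e) has_sum \<tau>) E"
    and "finite I" and "\<And>x. (\<Sum>i\<in>I. (x \<bullet> y i)\<^sup>2) \<le> C * (norm x)\<^sup>2"
  shows "(\<Sum>i\<in>I. y i \<bullet> R (y i)) \<le> C * \<tau>"
  using assms(6,2-5,7)
proof (induction I arbitrary: R \<tau> rule: finite_induct)
  case empty
  show ?case
  \<comment> \<open>The claim is 0 <= C * tau. The sign of C is known only in the presence of a unit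
    vector, and a nonzero tau forces E to contain one.\<close>
  proof (cases "\<tau> = 0")
    case False
    then obtain e :: 'a where "e \<in> E" using empty.prems(4) has_sum_empty
      by (metis all_not_in_conv has_sum_unique)
    then have "norm e = 1" using assms(1) by (simp add: is_onb_def)
    then have "0 \<le> C" using empty.prems(5)[of e] by simp
    moreover have "0 \<le> \<tau>"
      using has_sum_nonneg[OF empty.prems(4)] empty.prems(3) by (simp add: positive_op_def)
    ultimately show ?thesis by simp
  qed simp
next
  case (insert k I)
  note R = insert.prems(1-3)
  interpret bounded_linear R by fact
  define u where "u = R (y k)"
  define r where "r = y k \<bullet> u"
  have I: "(\<Sum>i\<in>I. (x \<bullet> y i)\<^sup>2) \<le> C * (norm x)\<^sup>2" for x
  proof -
    have "(\<Sum>i\<in>I. (x \<bullet> y i)\<^sup>2) \<le> (\<Sum>i\<in>insert k I. (x \<bullet> y i)\<^sup>2)"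
      using insert.hyps by (intro sum_mono2) auto
    then show ?thesis using insert.prems(5)[of x] by (rule order_trans)
  qed
  have "r \<ge> 0" using R(3) by (simp add: r_def u_def positive_op_def)
  show ?case
  proof (cases "r = 0")
    case True
    then show ?thesis
      using insert.IH[OF R insert.prems(4) I] insert.hyps by (simp add: r_def u_def)
  next
    case False
    with \<open>r \<ge> 0\<close> have r: "r > 0" by simp
    have sym: "x \<bullet> R z = R x \<bullet> z" for x z using R(2) by (simp add: self_adjoint_op_def)
    define S where "S = (\<lambda>x. R x - ((u \<bullet> x) / r) *\<^sub>R u)"
    have xS: "x \<bullet> S x = x \<bullet> R x - (u \<bullet> x)\<^sup>2 / r" for x
      by (simp add: S_def inner_diff_right power2_eq_square inner_commute)
    have "bounded_linear S"
      unfolding S_def divide_inverse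
      by (intro bounded_linear_sub R(1) bounded_linear_scaleR_const bounded_linear_mult_const
          bounded_linear_inner_right)
    moreover have "self_adjoint_op S"
      by (simp add: self_adjoint_op_def S_def inner_diff_left inner_diff_right sym inner_commute[of _ u])
    moreover have "positive_op S"
      unfolding positive_op_def
    proof
      fix x
      have "(u \<bullet> x)\<^sup>2 \<le> (x \<bullet> R x) * r"
        unfolding r_def u_def inner_commute[of "R (y k)" x]
        by (rule positive_op_Cauchy_Schwarz[OF R])
      then show "0 \<le> x \<bullet> S x" using r by (simp add: xS divide_le_eq)
    qed
    moreover have "((\<lambda>e. e \<bullet> S e) has_sum \<tau> - (norm u)\<^sup>2 / r) E"
      unfolding xS
      using has_sum_add[OF insert.prems(4) has_sum_cmult_left[OF is_onb_Parseval[OF assms(1), of u], of "- inverse r"]]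
      by (simp add: divide_inverse)
    ultimately have "(\<Sum>i\<in>I. y i \<bullet> S (y i)) \<le> C * (\<tau> - (norm u)\<^sup>2 / r)"
      by (rule insert.IH[OF _ _ _ _ I])
    also have "\<dots> = C * \<tau> - C * (norm u)\<^sup>2 / r" by (simp add: right_diff_distrib)
    also have "\<dots> \<le> C * \<tau> - (\<Sum>i\<in>insert k I. (u \<bullet> y i)\<^sup>2) / r"
      using insert.prems(5)[of u] r by (intro diff_left_mono divide_right_mono) auto
    \<comment> \<open>The index k contributes r^2 / r = r. This restores the summand of
      \<open>y k\<close>, which the Schur complement S annihilates.\<close>
    also have "(\<Sum>i\<in>insert k I. (u \<bullet> y i)\<^sup>2) / r = r + (\<Sum>i\<in>I. (u \<bullet> y i)\<^sup>2 / r)"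
      using insert.hyps r
      by (simp add: add_divide_distrib sum_divide_distrib r_def inner_commute power2_eq_square)
    finally show ?thesis
      using insert.hyps by (simp add: xS sum_subtractf r_def u_def)
  qed
qed

section \<open>Diagonalisation of finite-dimensional compressions\<close>

text \<open>The ambient space may be infinite-dimensional, where closed bounded sets need not be
  compact. The sphere is therefore placed inside the set of combinations with coefficients in
  [-1, 1], a finite sum of compact segments.\<close>

lemma compact_unit_sphere_span:
  fixes F :: "'a::real_inner set"
  assumes "orthonormal F" "finite F"
  shows "compact {x \<in> span F. norm x = 1}"
proof -
  define K where "K = (\<lambda>G. {\<Sum>f\<in>G. c f *\<^sub>R f | c :: 'a \<Rightarrow> real. \<forall>f\<in>G. \<bar>c f\<bar> \<le> 1})"
  have "compact (K G)" if "finite G" for G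
    using that
  proof (induction G rule: finite_induct)
    case empty
    then show ?case by (simp add: K_def)
  next
    case (insert g G)
    have eq: "K (insert g G) = {x + y | x y. x \<in> (\<lambda>t. t *\<^sub>R g) ` {-1..1::real} \<and> y \<in> K G}"
    proof (intro equalityI subsetI)
      fix z assume "z \<in> K (insert g G)"
      then obtain c where "\<forall>f\<in>insert g G. \<bar>c f\<bar> \<le> 1" "z = (\<Sum>f\<in>insert g G. c f *\<^sub>R f)"
        unfolding K_def by blast
      then show "z \<in> {x + y | x y. x \<in> (\<lambda>t. t *\<^sub>R g) ` {-1..1::real} \<and> y \<in> K G}"
        using insert.hyps by (fastforce simp: K_def abs_le_iff)
    next
      fix z assume "z \<in> {x + y | x y. x \<in> (\<lambda>t. t *\<^sub>R g) ` {-1..1::real} \<and> y \<in> K G}"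
      then obtain t c where tc: "\<bar>t\<bar> \<le> 1" "\<forall>f\<in>G. \<bar>c f\<bar> \<le> 1" "z = t *\<^sub>R g + (\<Sum>f\<in>G. c f *\<^sub>R f)"
        unfolding K_def by (auto simp: abs_le_iff)
      have "(\<Sum>f\<in>G. (c(g := t)) f *\<^sub>R f) = (\<Sum>f\<in>G. c f *\<^sub>R f)"
        using insert.hyps by (intro sum.cong) auto
      then show "z \<in> K (insert g G)"
        unfolding K_def using tc insert.hyps
        by (intro CollectI exI[of _ "c(g := t)"]) auto
    qed
    have "compact ((\<lambda>t. t *\<^sub>R g) ` {-1..1::real})"
      by (intro compact_continuous_image continuous_intros) auto
    then show ?case unfolding eq by (intro compact_sums insert.IH)
  qed
  then have "compact (K F \<inter> {x. norm x = 1})"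
    using assms by (intro compact_Int_closed closed_Collect_eq continuous_intros)
  moreover have "{x \<in> span F. norm x = 1} = K F \<inter> {x. norm x = 1}"
  proof (intro equalityI subsetI)
    fix x assume "x \<in> {x \<in> span F. norm x = 1}"
    then have x: "x \<in> span F" "norm x = 1" by auto
    have "\<bar>x \<bullet> f\<bar> \<le> 1" if "f \<in> F" for f
      using Cauchy_Schwarz_ineq2[of x f] x that assms(1) by (simp add: orthonormal_def)
    then have "x \<in> K F"
      unfolding K_def using orthonormal_Parseval_finite(1)[OF assms x(1)]
      by (intro CollectI exI[of _ "\<lambda>f. x \<bullet> f"]) simp
    with x show "x \<in> K F \<inter> {x. norm x = 1}" by simp
  next
    fix x assume "x \<in> K F \<inter> {x. norm x = 1}"
    then obtain c where "x = (\<Sum>f\<in>F. c f *\<^sub>R f)" "norm x = 1" unfolding K_def by blast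
    moreover have "(\<Sum>f\<in>F. c f *\<^sub>R f) \<in> span F" by (intro span_sum span_scale span_base)
    ultimately show "x \<in> {x \<in> span F. norm x = 1}" by simp
  qed
  ultimately show ?thesis by simp
qed

lemma orthonormal_independent: "orthonormal F \<Longrightarrow> independent F"
  unfolding orthonormal_def by (rule pairwise_orthogonal_independent) auto

lemma orthonormal_basis_span:
  fixes C :: "'a::real_inner set"
  assumes "finite C"
  obtains F where "finite F" "orthonormal F" "span F = span C"
proof -
  obtain D where D: "finite D" "span D = span C" "pairwise orthogonal D"
    using basis_orthogonal[OF assms] by blast
  define F where "F = (\<lambda>x. x /\<^sub>R norm x) ` (D - {0})"
  have "orthonormal F"
    unfolding orthonormal_def
  proof
    show "pairwise orthogonal F"
      using D(3) unfolding F_def pairwise_def orthogonal_def by auto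
    show "\<forall>e\<in>F. norm e = 1" by (auto simp: F_def)
  qed
  moreover have "span F = span C"
  proof -
    have "span F = span (D - {0})"
    proof (rule span_eq[THEN iffD2], intro conjI subsetI)
      fix x assume "x \<in> F"
      then obtain y where "y \<in> D - {0}" "x = y /\<^sub>R norm y" by (auto simp: F_def)
      then show "x \<in> span (D - {0})" by (simp only: span_scale[OF span_base])
    next
      fix x assume x: "x \<in> D - {0}"
      then have "norm x *\<^sub>R (x /\<^sub>R norm x) \<in> span F"
        by (intro span_scale span_base) (auto simp: F_def)
      with x show "x \<in> span F" by simp
    qed
    then show ?thesis using D(2) by (simp add: span_delete_0)
  qed
  moreover have "finite F" using D(1) by (simp add: F_def)
  ultimately show thesis by (rule that[rotated])
qed

text \<open>A maximiser \<open>g\<close> of the Rayleigh quotient on the unit sphere of \<open>span F\<close> satisfies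
  \<open>B g \<bullet> h = 0\<close> for all \<open>h\<close> in \<open>span F\<close> orthogonal to \<open>g\<close>.\<close>

lemma finite_orthonormal_diagonalize:
  fixes B :: "'a::real_inner \<Rightarrow> 'a"
  assumes "bounded_linear B" "self_adjoint_op B"
    and "finite F" "orthonormal F"
  obtains G where "finite G" "orthonormal G" "span G = span F"
    "\<forall>g\<in>G. \<forall>h\<in>G. g \<noteq> h \<longrightarrow> g \<bullet> B h = 0"
proof -
  interpret bounded_linear B by fact
  have sym: "x \<bullet> B y = y \<bullet> B x" for x y
    using assms(2) by (metis self_adjoint_op_def inner_commute)
  have "\<exists>G. finite G \<and> orthonormal G \<and> span G = span F
      \<and> (\<forall>g\<in>G. \<forall>h\<in>G. g \<noteq> h \<longrightarrow> g \<bullet> B h = 0)"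
    using assms(3,4)
  proof (induction "card F" arbitrary: F rule: less_induct)
    case less
    show ?case
    proof (cases "F = {}")
      case True
      then show ?thesis by (intro exI[of _ "{}"]) (simp add: orthonormal_def)
    next
      case False
      then obtain f where f: "f \<in> F" by blast
      let ?S = "{x \<in> span F. norm x = 1}"
      have "f \<in> ?S" using f less.prems(2) by (simp add: orthonormal_def span_base)
      moreover have "continuous_on ?S (\<lambda>x. x \<bullet> B x)"
        by (intro continuous_on_inner continuous_on_id linear_continuous_on assms)
      ultimately obtain g where g: "g \<in> ?S" and max: "\<And>x. x \<in> ?S \<Longrightarrow> x \<bullet> B x \<le> g \<bullet> B g"
        using continuous_attains_sup[OF compact_unit_sphere_span[OF less.prems(2,1)]] by blast
      then have gg: "g \<bullet> g = 1" "g \<in> span F" by (auto simp: norm_eq_1)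
      define m where "m = g \<bullet> B g"
      have max': "x \<bullet> B x \<le> m * (x \<bullet> x)" if "x \<in> span F" for x
      proof (cases "x = 0")
        case False
        have "(x /\<^sub>R norm x) \<bullet> B (x /\<^sub>R norm x) \<le> m"
          unfolding m_def by (rule max) (use that False in \<open>simp add: span_scale\<close>)
        then have "(x \<bullet> B x) / (norm x)\<^sup>2 \<le> m"
          by (simp add: scaleR power2_eq_square divide_inverse ac_simps)
        then show ?thesis using False by (simp add: divide_le_eq power2_norm_eq_inner)
      qed (simp add: zero)
      \<comment> \<open>The form m * (x \<bullet> x) - x \<bullet> B x is nonnegative on the span
        and vanishes at g. Along g + t * h its linear coefficient in t must therefore be 0.\<close>
      have crit: "g \<bullet> B h = 0" if h: "h \<in> span F" "g \<bullet> h = 0" for h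
      proof -
        have "0 \<le> (m * (h \<bullet> h) - h \<bullet> B h) * t\<^sup>2 + (- 2 * (g \<bullet> B h)) * t" for t
        proof -
          have "g + t *\<^sub>R h \<in> span F" using gg h by (intro span_add span_scale)
          from max'[OF this] show ?thesis
            using h(2) gg(1)
            by (simp add: add scaleR inner_add_left inner_add_right sym[of h g] inner_commute[of h g]
                m_def[symmetric] power2_eq_square algebra_simps)
        qed
        from quadratic_nonneg_imp_linear_coeff_zero[OF this] show ?thesis by simp
      qed
      \<comment> \<open>Removing the g-component from each vector of F spans the orthogonal
        complement of g inside \<open>span F\<close>, the space for the recursive call.\<close>
      define C where "C = (\<lambda>f. f - (g \<bullet> f) *\<^sub>R g) ` F"
      obtain F' where F': "finite F'" "orthonormal F'" "span F' = span C"
        using orthonormal_basis_span[of C] less.prems(1) by (auto simp: C_def)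
      have C_sub: "C \<subseteq> span F \<inter> {x. g \<bullet> x = 0}"
        using gg by (auto simp: C_def inner_diff_right span_base span_diff span_scale)
      have C_span: "span C \<subseteq> span F \<inter> {x. g \<bullet> x = 0}"
      proof (rule span_minimal[OF C_sub])
        show "subspace (span F \<inter> {x. g \<bullet> x = 0})"
          by (intro subspace_inter subspace_span) (auto simp: subspace_def inner_add_right)
      qed
      have span_eq: "span (insert g G) = span F" if "span G = span C" for G
      proof (rule span_eq[THEN iffD2], intro conjI subsetI)
        fix x assume "x \<in> insert g G"
        then show "x \<in> span F" using gg(2) C_span that span_base[of x G] by auto
      next
        fix x assume "x \<in> F"
        then have "x - (g \<bullet> x) *\<^sub>R g \<in> span G" unfolding that by (auto simp: C_def intro!: span_base)
        then have "x - (g \<bullet> x) *\<^sub>R g + (g \<bullet> x) *\<^sub>R g \<in> span (insert g G)"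
          by (intro span_add span_scale[OF span_base])
             (use span_mono[of G "insert g G"] in auto)
        then show "x \<in> span (insert g G)" by simp
      qed
      have ortho: "orthonormal (insert g G)" "g \<notin> G"
        if "orthonormal G" "span G = span C" for G
      proof -
        have 0: "g \<bullet> x = 0" if "x \<in> G" for x
          using C_span \<open>span G = span C\<close> span_base[OF that] by auto
        then show "g \<notin> G" using gg(1) by force
        show "orthonormal (insert g G)"
          using that(1) 0 g unfolding orthonormal_def pairwise_insert
          by (auto simp: orthogonal_def inner_commute)
      qed
      \<comment> \<open>Termination: \<open>insert g F'\<close> is independent inside
        \<open>span F\<close>, so F' has fewer elements than F.\<close>
      have "card (insert g F') \<le> card F"
        using independent_span_bound[OF less.prems(1) orthonormal_independent[OF ortho(1)[OF F'(2,3)]]]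
          span_eq[OF F'(3)] span_superset[of "insert g F'"] by simp
      then have "card F' < card F" using F'(1) ortho(2)[OF F'(2,3)] by simp
      from less.hyps[OF this F'(1,2)] obtain G
        where G: "finite G" "orthonormal G" "span G = span F'"
          "\<forall>g\<in>G. \<forall>h\<in>G. g \<noteq> h \<longrightarrow> g \<bullet> B h = 0"
        by (elim exE conjE)
      note GC = G(3)[unfolded F'(3)]
      have g0: "g \<bullet> B h = 0 \<and> h \<bullet> B g = 0" if "h \<in> G" for h
      proof -
        have "h \<in> span C" using span_base[OF that] unfolding GC .
        then have "g \<bullet> B h = 0" using crit C_span by blast
        with sym[of g h] show ?thesis by simp
      qed
      have "\<forall>a\<in>insert g G. \<forall>b\<in>insert g G. a \<noteq> b \<longrightarrow> a \<bullet> B b = 0"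
        using G(4) g0 by blast
      moreover have "finite (insert g G)" using G(1) by simp
      ultimately show ?thesis
        using ortho(1)[OF G(2) GC] span_eq[OF GC] by blast
    qed
  qed
  then obtain G where "finite G" "orthonormal G" "span G = span F"
    "\<forall>g\<in>G. \<forall>h\<in>G. g \<noteq> h \<longrightarrow> g \<bullet> B h = 0"
    by (elim exE conjE)
  then show thesis by (rule that)
qed

text \<open>Both sums are the squared norm of the projection of x onto the common span. This permits
  replacing the given system by a diagonalising one.\<close>

lemma orthonormal_sum_inner_cong:
  assumes "orthonormal F" "finite F" "orthonormal G" "finite G" "span F = span G"
  shows "(\<Sum>f\<in>F. (x \<bullet> f)\<^sup>2) = (\<Sum>g\<in>G. (x \<bullet> g)\<^sup>2)"
proof -
  have le: "(\<Sum>f\<in>F. (x \<bullet> f)\<^sup>2) \<le> (\<Sum>g\<in>G. (x \<bullet> g)\<^sup>2)"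
    if F: "orthonormal F" "finite F" and G: "orthonormal G" "finite G" and "span F \<subseteq> span G"
    for F G :: "'a set"
  proof -
    define p where "p = (\<Sum>g\<in>G. (x \<bullet> g) *\<^sub>R g)"
    have p: "p \<in> span G" unfolding p_def by (intro span_sum span_scale span_base)
    have pg: "p \<bullet> g = x \<bullet> g" if "g \<in> G" for g
    proof -
      have "p \<bullet> g = (\<Sum>h\<in>G. if h = g then x \<bullet> h else 0)"
        unfolding p_def inner_sum_left using orthonormal_inner[OF G(1) _ that]
        by (intro sum.cong) auto
      then show ?thesis using that G(2) by simp
    qed
    have "x \<bullet> f = p \<bullet> f" if "f \<in> F" for f
    proof -
      have "f \<in> span G" using \<open>span F \<subseteq> span G\<close> span_base that by blast
      then have "(\<Sum>g\<in>G. (f \<bullet> g) *\<^sub>R g) = f" by (rule orthonormal_Parseval_finite(1)[OF G])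
      then have "(x - p) \<bullet> f = (\<Sum>g\<in>G. (f \<bullet> g) * ((x - p) \<bullet> g))"
        by (metis (no_types, lifting) inner_scaleR_right inner_sum_right sum.cong)
      also have "\<dots> = 0" by (simp add: inner_diff_left pg)
      finally show ?thesis by (simp add: inner_diff_left)
    qed
    then have "(\<Sum>f\<in>F. (x \<bullet> f)\<^sup>2) = (\<Sum>f\<in>F. (p \<bullet> f)\<^sup>2)" by simp
    also have "\<dots> \<le> (norm p)\<^sup>2" by (rule orthonormal_Bessel[OF F])
    also have "\<dots> = (\<Sum>g\<in>G. (x \<bullet> g)\<^sup>2)"
      using orthonormal_Parseval_finite(2)[OF G p] pg by simp
    finally show ?thesis .
  qed
  show ?thesis by (intro antisym le assms) (simp_all add: assms)
qed

section \<open>Exponential moments of sums of squares\<close>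

lemma nn_integral_normal_density:
  assumes "0 < \<sigma>"
  shows "(\<integral>\<^sup>+ x. ennreal (normal_density \<mu> \<sigma> x) \<partial>lborel) = 1"
  using assms by (subst nn_integral_eq_integral) auto

lemma nn_integral_std_normal_exp:
  "(\<integral>\<^sup>+ x. ennreal (std_normal_density x) * ennreal (exp (a * x)) \<partial>lborel) = ennreal (exp (a\<^sup>2 / 2))"
proof -
  have "std_normal_density x * exp (a * x) = exp (a\<^sup>2 / 2) * normal_density a 1 x" for x
  proof -
    have "exp (- x\<^sup>2 / 2) * exp (a * x) = exp (a\<^sup>2 / 2) * exp (- (x - a)\<^sup>2 / 2)"
      unfolding exp_add[symmetric] by (simp add: power2_diff field_simps)
    then show ?thesis by (simp add: std_normal_density_def normal_density_def field_simps)
  qed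
  then have "(\<integral>\<^sup>+ x. ennreal (std_normal_density x) * ennreal (exp (a * x)) \<partial>lborel)
      = (\<integral>\<^sup>+ x. ennreal (exp (a\<^sup>2 / 2)) * ennreal (normal_density a 1 x) \<partial>lborel)"
    by (intro nn_integral_cong) (simp flip: ennreal_mult)
  then show ?thesis by (simp add: nn_integral_cmult nn_integral_normal_density)
qed

lemma nn_integral_std_normal_exp_square:
  assumes "c < 1 / 2"
  shows "(\<integral>\<^sup>+ x. ennreal (std_normal_density x) * ennreal (exp (c * x\<^sup>2)) \<partial>lborel)
    = ennreal (1 / sqrt (1 - 2 * c))"
proof -
  \<comment> \<open>The weight exp (c * x^2) turns the standard Gaussian into a centred one with
    standard deviation s, up to the factor s.\<close>
  define s where "s = 1 / sqrt (1 - 2 * c)"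
  have s: "s > 0" "s\<^sup>2 = 1 / (1 - 2 * c)" using assms by (auto simp: s_def power_divide)
  have "std_normal_density x * exp (c * x\<^sup>2) = s * normal_density 0 s x" for x
  proof -
    have e: "exp (- x\<^sup>2 / 2) * exp (c * x\<^sup>2) = exp (- x\<^sup>2 / (2 * s\<^sup>2))"
      using assms unfolding exp_add[symmetric] s(2) by (simp add: field_simps)
    have n: "s * (1 / sqrt (2 * pi * s\<^sup>2)) = 1 / sqrt (2 * pi)"
      using s(1) by (simp add: real_sqrt_mult)
    have "std_normal_density x * exp (c * x\<^sup>2)
        = 1 / sqrt (2 * pi) * (exp (- x\<^sup>2 / 2) * exp (c * x\<^sup>2))"
      by (simp add: std_normal_density_def)
    also have "\<dots> = s * normal_density 0 s x"
      unfolding e n[symmetric] by (simp add: normal_density_def)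
    finally show ?thesis .
  qed
  then have "(\<integral>\<^sup>+ x. ennreal (std_normal_density x) * ennreal (exp (c * x\<^sup>2)) \<partial>lborel)
      = (\<integral>\<^sup>+ x. ennreal s * ennreal (normal_density 0 s x) \<partial>lborel)"
    using s by (intro nn_integral_cong) (simp flip: ennreal_mult)
  then show ?thesis using s by (simp add: nn_integral_cmult nn_integral_normal_density s_def)
qed

text \<open>Each factor \<open>exp (l * (Y \<bullet> g)\<^sup>2)\<close> is the moment generating function of a standard Gaussian \<open>x\<close>
  at \<open>sqrt (2 * l) * (Y \<bullet> g)\<close>, so that by Fubini it only shifts \<open>w\<close> by a random multiple of \<open>g\<close>.
  For the next factor this shift is invisible because \<open>G\<close> is orthogonal for the form of \<open>B\<close>.\<close>

lemma nn_integral_exp_sum_squares_le: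
  fixes Y :: "'w \<Rightarrow> 'b::{real_inner, second_countable_topology}"
  assumes "sigma_finite_measure M" and Y[measurable]: "Y \<in> borel_measurable M"
    and B: "bounded_linear B" "self_adjoint_op B"
    and sub: "\<And>w. (\<integral>\<^sup>+\<omega>. ennreal (exp (w \<bullet> Y \<omega>)) \<partial>M) \<le> ennreal (exp ((w \<bullet> B w) / 2))"
    and "finite G" and "l \<ge> 0"
    and "\<And>g h. g \<in> G \<Longrightarrow> h \<in> G \<Longrightarrow> g \<noteq> h \<Longrightarrow> g \<bullet> B h = 0"
    and "\<And>g. g \<in> G \<Longrightarrow> 2 * l * (g \<bullet> B g) < 1"
    and "\<And>g. g \<in> G \<Longrightarrow> w \<bullet> B g = 0"
  shows "(\<integral>\<^sup>+\<omega>. ennreal (exp (w \<bullet> Y \<omega> + l * (\<Sum>g\<in>G. (Y \<omega> \<bullet> g)\<^sup>2))) \<partial>M)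
    \<le> ennreal (exp ((w \<bullet> B w) / 2) * (\<Prod>g\<in>G. 1 / sqrt (1 - 2 * l * (g \<bullet> B g))))"
  using assms(6,8-)
proof (induction G arbitrary: w rule: finite_induct)
  case empty
  then show ?case using sub by simp
next
  case (insert k G)
  interpret bounded_linear B by fact
  interpret M: sigma_finite_measure M by fact
  interpret pair_sigma_finite M lborel ..
  define Q where "Q = (\<Prod>g\<in>G. 1 / sqrt (1 - 2 * l * (g \<bullet> B g)))"
  have "Q \<ge> 0" unfolding Q_def using insert.prems(2) by (intro prod_nonneg) (auto intro: less_imp_le)
  define v where "v = (\<lambda>x. w + (sqrt (2 * l) * x) *\<^sub>R k)"
  define f where "f = (\<lambda>x \<omega>. ennreal (exp (v x \<bullet> Y \<omega> + l * (\<Sum>g\<in>G. (Y \<omega> \<bullet> g)\<^sup>2))))"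
  have [measurable]: "(\<lambda>(x, \<omega>). f x \<omega>) \<in> borel_measurable (lborel \<Otimes>\<^sub>M M)"
    "(\<lambda>(\<omega>, x). f x \<omega>) \<in> borel_measurable (M \<Otimes>\<^sub>M lborel)"
    unfolding f_def v_def by measurable
  have split: "ennreal (exp (w \<bullet> Y \<omega> + l * (\<Sum>g\<in>insert k G. (Y \<omega> \<bullet> g)\<^sup>2)))
      = (\<integral>\<^sup>+x. ennreal (std_normal_density x) * f x \<omega> \<partial>lborel)" for \<omega>
  proof -
    define a where "a = sqrt (2 * l) * (Y \<omega> \<bullet> k)"
    define S where "S = w \<bullet> Y \<omega> + l * (\<Sum>g\<in>G. (Y \<omega> \<bullet> g)\<^sup>2)"
    have "f x \<omega> = ennreal (exp S) * ennreal (exp (a * x))" for x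
    proof -
      have eq: "v x \<bullet> Y \<omega> + l * (\<Sum>g\<in>G. (Y \<omega> \<bullet> g)\<^sup>2) = S + a * x"
        by (simp add: v_def S_def a_def inner_add_left inner_commute[of k])
      show ?thesis unfolding f_def eq by (simp only: exp_add ennreal_mult exp_ge_zero)
    qed
    then have "(\<integral>\<^sup>+x. ennreal (std_normal_density x) * f x \<omega> \<partial>lborel)
        = (\<integral>\<^sup>+x. ennreal (exp S) * (ennreal (std_normal_density x) * ennreal (exp (a * x))) \<partial>lborel)"
      by (simp add: ac_simps)
    also have "\<dots> = ennreal (exp S) * ennreal (exp (a\<^sup>2 / 2))"
      by (simp add: nn_integral_cmult nn_integral_std_normal_exp)
    also have "\<dots> = ennreal (exp (S + a\<^sup>2 / 2))" by (simp add: exp_add flip: ennreal_mult)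
    also have "a\<^sup>2 / 2 = l * (Y \<omega> \<bullet> k)\<^sup>2" using \<open>l \<ge> 0\<close> by (simp add: a_def power_mult_distrib)
    finally show ?thesis
      using insert.hyps by (simp add: S_def algebra_simps)
  qed
  \<comment> \<open>The cross terms vanish because w is B-orthogonal to k, so x enters only through
    x^2 and a one-dimensional Gaussian integral remains.\<close>
  have form: "v x \<bullet> B (v x) = w \<bullet> B w + 2 * (l * (k \<bullet> B k) * x\<^sup>2)" for x
  proof -
    have "w \<bullet> B k = 0" using insert.prems(3) by simp
    moreover from this have "k \<bullet> B w = 0"
      using B(2) by (metis self_adjoint_op_def inner_commute)
    moreover have "(sqrt (2 * l) * x) * (sqrt (2 * l) * x) = 2 * l * x\<^sup>2"
      using \<open>l \<ge> 0\<close> by (simp add: power2_eq_square)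
    ultimately show ?thesis
      by (simp add: v_def add scaleR inner_add_left inner_add_right mult.assoc[symmetric])
  qed
  have "(\<integral>\<^sup>+\<omega>. ennreal (exp (w \<bullet> Y \<omega> + l * (\<Sum>g\<in>insert k G. (Y \<omega> \<bullet> g)\<^sup>2))) \<partial>M)
      = (\<integral>\<^sup>+\<omega>. \<integral>\<^sup>+x. ennreal (std_normal_density x) * f x \<omega> \<partial>lborel \<partial>M)"
    unfolding split ..
  also have "\<dots> = (\<integral>\<^sup>+x. \<integral>\<^sup>+\<omega>. ennreal (std_normal_density x) * f x \<omega> \<partial>M \<partial>lborel)"
    by (rule Fubini'[symmetric]) measurable
  also have "\<dots> = (\<integral>\<^sup>+x. ennreal (std_normal_density x) * (\<integral>\<^sup>+\<omega>. f x \<omega> \<partial>M) \<partial>lborel)"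
    by (intro nn_integral_cong nn_integral_cmult) measurable
  also have "\<dots> \<le> (\<integral>\<^sup>+x. ennreal (std_normal_density x)
      * ennreal (exp ((v x \<bullet> B (v x)) / 2) * Q) \<partial>lborel)"
  proof (intro nn_integral_mono mult_left_mono)
    fix x
    have "v x \<bullet> B g = 0" if "g \<in> G" for g
      using insert.prems(1)[of k g] insert.prems(3)[of g] that insert.hyps
      by (auto simp: v_def inner_add_left)
    then show "(\<integral>\<^sup>+\<omega>. f x \<omega> \<partial>M) \<le> ennreal (exp ((v x \<bullet> B (v x)) / 2) * Q)"
      unfolding f_def Q_def using insert.prems by (intro insert.IH) auto
  qed simp
  also have "\<dots> = (\<integral>\<^sup>+x. ennreal (exp ((w \<bullet> B w) / 2) * Q)
      * (ennreal (std_normal_density x) * ennreal (exp (l * (k \<bullet> B k) * x\<^sup>2))) \<partial>lborel)"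
    using \<open>Q \<ge> 0\<close> unfolding form add_divide_distrib exp_add
    by (intro nn_integral_cong) (simp add: ac_simps flip: ennreal_mult)
  also have "\<dots> = ennreal (exp ((w \<bullet> B w) / 2) * Q) * ennreal (1 / sqrt (1 - 2 * (l * (k \<bullet> B k))))"
    using insert.prems(2)[of k]
    by (subst nn_integral_cmult) (auto intro!: arg_cong2[of _ _ _ _ "(*)"] nn_integral_std_normal_exp_square)
  also have "\<dots> = ennreal (exp ((w \<bullet> B w) / 2) * (\<Prod>g\<in>insert k G. 1 / sqrt (1 - 2 * l * (g \<bullet> B g))))"
    using insert.hyps insert.prems(2)[of k] \<open>Q \<ge> 0\<close>
    by (subst ennreal_mult[symmetric]) (auto simp: Q_def ac_simps)
  finally show ?case .
qed

text \<open>Used at x = 2 * l * (g \<bullet> B g): the linear term adds up to the trace, the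
  quadratic one to the squared Hilbert-Schmidt norm, and 1 - x is controlled by the operator norm.
  Twice the gap between the exponents vanishes at 0 and has derivative y^2 / (2 * (1 -
  y)^2).\<close>

lemma inverse_sqrt_le_exp:
  fixes x :: real
  assumes "0 \<le> x" "x < 1"
  shows "1 / sqrt (1 - x) \<le> exp (x / 2 + x\<^sup>2 / (4 * (1 - x)))"
proof -
  define \<phi> where "\<phi> = (\<lambda>x :: real. x + x\<^sup>2 / (2 * (1 - x)) + ln (1 - x))"
  have "\<phi> 0 \<le> \<phi> x"
  proof (rule DERIV_nonneg_imp_nondecreasing[OF assms(1)])
    fix y assume "0 \<le> y" "y \<le> x"
    then have y: "y < 1" using assms by simp
    have "(\<phi> has_real_derivative
        1 + (2 * y * (2 * (1 - y)) + 2 * y\<^sup>2) / (2 * (1 - y))\<^sup>2 - 1 / (1 - y)) (at y)"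
      unfolding \<phi>_def using y
      by (auto intro!: derivative_eq_intros simp: power2_eq_square)
    also have "1 + (2 * y * (2 * (1 - y)) + 2 * y\<^sup>2) / (2 * (1 - y))\<^sup>2 - 1 / (1 - y)
        = y\<^sup>2 / (2 * (1 - y)\<^sup>2)"
      using y by (simp add: divide_simps) (simp add: power2_eq_square algebra_simps)
    finally have "(\<phi> has_real_derivative y\<^sup>2 / (2 * (1 - y)\<^sup>2)) (at y)" .
    then show "\<exists>z. (\<phi> has_real_derivative z) (at y) \<and> 0 \<le> z" by (intro exI conjI) auto
  qed
  moreover have "x\<^sup>2 / (2 * (1 - x)) = 2 * (x\<^sup>2 / (4 * (1 - x)))"
    using assms by (simp add: divide_simps)
  ultimately have le: "- ln (1 - x) / 2 \<le> x / 2 + x\<^sup>2 / (4 * (1 - x))"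
    by (simp add: \<phi>_def)
  have "1 / sqrt (1 - x) = exp (- ln (sqrt (1 - x)))"
    using assms by (simp add: exp_minus inverse_eq_divide)
  also have "\<dots> = exp (- ln (1 - x) / 2)" using assms by (simp add: ln_sqrt)
  also have "\<dots> \<le> exp (x / 2 + x\<^sup>2 / (4 * (1 - x)))" using le by simp
  finally show ?thesis .
qed

section \<open>Tail bounds\<close>

text \<open>The numbers tau and h are mere upper bounds for every finite orthonormal system, so the
  caller may enlarge h. Strict positivity of h keeps d = h / (h + 2 * b * s) positive.\<close>

lemma finite_orthonormal_tail_bound:
  fixes Y :: "'w \<Rightarrow> 'b::{real_inner, second_countable_topology}"
  assumes "prob_space M" and Y[measurable]: "Y \<in> borel_measurable M"
    and B: "bounded_linear B" "self_adjoint_op B" "positive_op B"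
    and sub: "\<And>w. (\<integral>\<^sup>+\<omega>. ennreal (exp (w \<bullet> Y \<omega>)) \<partial>M) \<le> ennreal (exp ((w \<bullet> B w) / 2))"
    and F: "finite F" "orthonormal F"
    and trace: "\<And>G. finite G \<Longrightarrow> orthonormal G \<Longrightarrow> (\<Sum>g\<in>G. g \<bullet> B g) \<le> \<tau>"
    and hs: "\<And>G. finite G \<Longrightarrow> orthonormal G \<Longrightarrow> (\<Sum>g\<in>G. (norm (B g))\<^sup>2) \<le> h\<^sup>2"
    and h: "h > 0" and t: "t \<ge> 0"
  shows "measure M {\<omega> \<in> space M. (\<Sum>f\<in>F. (Y \<omega> \<bullet> f)\<^sup>2) > \<tau> + 2 * sqrt t * h + 2 * t * onorm B}
    \<le> exp (- t)"
\<comment> \<open>At t = 0 the Chernoff parameter would vanish, but the claimed bound is then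
  1.\<close>
proof (cases "t = 0")
  case True
  then show ?thesis using assms(1) by (simp add: prob_space.prob_le_1)
next
  case False
  interpret prob_space M by fact
  obtain G where G: "finite G" "orthonormal G" "span G = span F"
    "\<forall>g\<in>G. \<forall>h\<in>G. g \<noteq> h \<longrightarrow> g \<bullet> B h = 0"
    by (rule finite_orthonormal_diagonalize[OF B(1,2) F])
  define b where "b = onorm B"
  define s where "s = sqrt t"
  define l where "l = s / (h + 2 * b * s)" \<comment> \<open>optimal Chernoff parameter\<close>
  define c where "c = \<tau> + 2 * s * h + 2 * t * b"
  define d where "d = 1 - 2 * l * b"
  have "b \<ge> 0" unfolding b_def by (rule onorm_pos_le[OF B(1)])
  have s: "s > 0" "s\<^sup>2 = t" using t False by (auto simp: s_def)
  have den: "h + 2 * b * s > 0" using h s \<open>b \<ge> 0\<close> by (intro add_pos_nonneg) auto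
  have "l > 0" using s den by (simp add: l_def)
  have d_eq: "d = h / (h + 2 * b * s)" using den by (simp add: d_def l_def field_simps)
  then have "d > 0" using h den by simp
  have eig: "0 \<le> g \<bullet> B g" "g \<bullet> B g \<le> b" "(g \<bullet> B g)\<^sup>2 \<le> (norm (B g))\<^sup>2" if "g \<in> G" for g
  proof -
    have "norm g = 1" using that G(2) by (simp add: orthonormal_def)
    then have "\<bar>g \<bullet> B g\<bar> \<le> norm (B g)" "norm (B g) \<le> b"
      using Cauchy_Schwarz_ineq2[of g "B g"] onorm[OF B(1), of g] by (auto simp: b_def)
    then show "g \<bullet> B g \<le> b" "(g \<bullet> B g)\<^sup>2 \<le> (norm (B g))\<^sup>2"
      by (auto simp: abs_le_square_iff[symmetric])
    show "0 \<le> g \<bullet> B g" using B(3) by (simp add: positive_op_def)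
  qed
  have lt: "2 * l * (g \<bullet> B g) \<le> 1 - d" if "g \<in> G" for g
    using eig(2)[OF that] \<open>l > 0\<close> by (simp add: d_def)
  have "(\<Prod>g\<in>G. 1 / sqrt (1 - 2 * l * (g \<bullet> B g)))
      \<le> (\<Prod>g\<in>G. exp (l * (g \<bullet> B g) + l\<^sup>2 / d * (g \<bullet> B g)\<^sup>2))"
  proof (intro prod_mono conjI)
    fix g assume g: "g \<in> G"
    define x where "x = 2 * l * (g \<bullet> B g)"
    have x: "0 \<le> x" "x \<le> 1 - d" using lt[OF g] eig(1)[OF g] \<open>l > 0\<close> by (auto simp: x_def)
    then show "0 \<le> 1 / sqrt (1 - x)" using \<open>d > 0\<close> by simp
    have "1 / sqrt (1 - x) \<le> exp (x / 2 + x\<^sup>2 / (4 * (1 - x)))"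
      using x \<open>d > 0\<close> by (intro inverse_sqrt_le_exp) auto
    \<comment> \<open>The common denominator d, the worst case over G, makes the quadratic terms
      summable to a multiple of h^2.\<close>
    also have "\<dots> \<le> exp (x / 2 + x\<^sup>2 / (4 * d))"
      unfolding exp_le_cancel_iff using x \<open>d > 0\<close>
      by (intro add_left_mono divide_left_mono mult_pos_pos) auto
    also have "x / 2 + x\<^sup>2 / (4 * d) = l * (g \<bullet> B g) + l\<^sup>2 / d * (g \<bullet> B g)\<^sup>2"
      by (simp add: x_def power_mult_distrib)
    finally show "1 / sqrt (1 - x) \<le> exp (l * (g \<bullet> B g) + l\<^sup>2 / d * (g \<bullet> B g)\<^sup>2)" .
  qed
  also have "\<dots> = exp (l * (\<Sum>g\<in>G. g \<bullet> B g) + l\<^sup>2 / d * (\<Sum>g\<in>G. (g \<bullet> B g)\<^sup>2))"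
    by (simp add: exp_sum[OF G(1), symmetric] sum.distrib sum_distrib_left)
  also have "\<dots> \<le> exp (l * \<tau> + l\<^sup>2 / d * h\<^sup>2)"
  proof -
    have "(\<Sum>g\<in>G. (g \<bullet> B g)\<^sup>2) \<le> (\<Sum>g\<in>G. (norm (B g))\<^sup>2)" by (intro sum_mono eig)
    also have "\<dots> \<le> h\<^sup>2" by (rule hs[OF G(1,2)])
    finally show ?thesis
      unfolding exp_le_cancel_iff using trace[OF G(1,2)] \<open>l > 0\<close> \<open>d > 0\<close>
      by (intro add_mono mult_left_mono) auto
  qed
  finally have prod: "(\<Prod>g\<in>G. 1 / sqrt (1 - 2 * l * (g \<bullet> B g))) \<le> exp (l * \<tau> + l\<^sup>2 / d * h\<^sup>2)" .
  have "(\<integral>\<^sup>+\<omega>. ennreal (exp (0 \<bullet> Y \<omega> + l * (\<Sum>g\<in>G. (Y \<omega> \<bullet> g)\<^sup>2))) \<partial>M)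
      \<le> ennreal (exp ((0 \<bullet> B 0) / 2) * (\<Prod>g\<in>G. 1 / sqrt (1 - 2 * l * (g \<bullet> B g))))"
    using lt \<open>d > 0\<close> \<open>l > 0\<close> G(1,4) sub
    by (intro nn_integral_exp_sum_squares_le[OF sigma_finite_measure_axioms Y B(1,2)]) force+
  then have mgf: "(\<integral>\<^sup>+\<omega>. ennreal (exp (l * (\<Sum>g\<in>G. (Y \<omega> \<bullet> g)\<^sup>2))) \<partial>M)
      \<le> ennreal (exp (l * \<tau> + l\<^sup>2 / d * h\<^sup>2))"
    using order_trans[OF _ ennreal_leI[OF prod]] by simp
  have "emeasure M {\<omega> \<in> space M. (\<Sum>f\<in>F. (Y \<omega> \<bullet> f)\<^sup>2) > c}
      \<le> emeasure M {\<omega> \<in> space M. (\<Sum>g\<in>G. (Y \<omega> \<bullet> g)\<^sup>2) \<ge> c}"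
    unfolding orthonormal_sum_inner_cong[OF F(2,1) G(2,1) G(3)[symmetric]]
    by (intro emeasure_mono) auto
  also have "\<dots> \<le> ennreal (exp (- l * c)) * (\<integral>\<^sup>+\<omega>\<in>space M. ennreal (exp (l * (\<Sum>g\<in>G. (Y \<omega> \<bullet> g)\<^sup>2))) \<partial>M)"
    by (intro Chernoff_ineq_nn_integral_ge \<open>l > 0\<close>) auto
  also have "(\<integral>\<^sup>+\<omega>\<in>space M. ennreal (exp (l * (\<Sum>g\<in>G. (Y \<omega> \<bullet> g)\<^sup>2))) \<partial>M)
      = (\<integral>\<^sup>+\<omega>. ennreal (exp (l * (\<Sum>g\<in>G. (Y \<omega> \<bullet> g)\<^sup>2))) \<partial>M)"
    by (intro nn_integral_cong) simp
  also have "ennreal (exp (- l * c)) * \<dots> \<le> ennreal (exp (- l * c)) * ennreal (exp (l * \<tau> + l\<^sup>2 / d * h\<^sup>2))"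
    by (intro mult_left_mono mgf) simp
  also have "\<dots> = ennreal (exp (- t))"
  proof -
    \<comment> \<open>With q = h + 2 * b * s, the gain l * (c - tau) is s^2 * (2 * h + 2 * b * s) /
      q and the loss is s^2 * h / q; their difference is s^2 = t.\<close>
    have cancel: "(s / q)\<^sup>2 / (h / q) * h\<^sup>2 = s\<^sup>2 * h / q" if "q \<noteq> 0" "h \<noteq> 0" for q
      using that by (simp add: power2_eq_square)
    have "l\<^sup>2 / d * h\<^sup>2 = s\<^sup>2 * h / (h + 2 * b * s)"
      unfolding d_eq l_def using den h by (intro cancel) auto
    moreover have "l * (2 * s * h + 2 * t * b) = s\<^sup>2 * (2 * h + 2 * b * s) / (h + 2 * b * s)"
      by (simp add: l_def s(2)[symmetric] power2_eq_square algebra_simps add_divide_distrib)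
    ultimately have "l * (2 * s * h + 2 * t * b) - l\<^sup>2 / d * h\<^sup>2 = s\<^sup>2 * (h + 2 * b * s) / (h + 2 * b * s)"
      by (simp add: diff_divide_distrib[symmetric] algebra_simps)
    also have "\<dots> = t" using den s(2) by simp
    finally have "- l * c + (l * \<tau> + l\<^sup>2 / d * h\<^sup>2) = - t" by (simp add: c_def algebra_simps)
    then show ?thesis by (simp only: ennreal_mult[symmetric] exp_ge_zero exp_add[symmetric])
  qed
  finally have "measure M {\<omega> \<in> space M. (\<Sum>f\<in>F. (Y \<omega> \<bullet> f)\<^sup>2) > c} \<le> exp (- t)"
    unfolding emeasure_eq_measure by simp
  then show ?thesis by (simp add: c_def s_def b_def)
qed

lemma subgaussian_nn_integral_exp_le:
  assumes "subgaussian M R X"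
  shows "(\<integral>\<^sup>+\<omega>. ennreal (exp (u \<bullet> X \<omega>)) \<partial>M) \<le> ennreal (exp ((u \<bullet> R u) / 2))"
proof -
  define v where "v = (\<integral>\<omega>. exp (u \<bullet> X \<omega>) \<partial>M)"
  have int: "integrable M (\<lambda>\<omega>. exp (u \<bullet> X \<omega>))" and le: "ln v \<le> (u \<bullet> R u) / 2"
    using assms by (auto simp: subgaussian_def v_def)
  have "v \<le> exp ((u \<bullet> R u) / 2)"
  \<comment> \<open>The bound on \<open>ln v\<close> can be exponentiated only for positive v;
    otherwise v lies below the positive right side anyway.\<close>
  proof (cases "v > 0")
    case True
    then show ?thesis using le by (metis exp_le_cancel_iff exp_ln)
  next
    case False
    then show ?thesis using exp_gt_zero[of "(u \<bullet> R u) / 2"] by linarith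
  qed
  then show ?thesis
    unfolding v_def by (subst nn_integral_eq_integral[OF int]) (auto intro: ennreal_leI)
qed

text \<open>The finite bound is used with h + 1 / (n + 1), which also covers h = 0. The induced
  slack decreases while the partial sums increase, so the events S n increase to exactly the event
  of the claim. The strict inequality in the event matters here: any excess over c eventually beats
  the slack.\<close>

lemma orthonormal_basis_tail_bound:
  fixes Y :: "'w \<Rightarrow> 'b::{real_inner, second_countable_topology}"
  assumes "prob_space M" and Y[measurable]: "Y \<in> borel_measurable M"
    and B: "bounded_linear B" "self_adjoint_op B" "positive_op B"
    and sub: "\<And>w. (\<integral>\<^sup>+\<omega>. ennreal (exp (w \<bullet> Y \<omega>)) \<partial>M) \<le> ennreal (exp ((w \<bullet> B w) / 2))"
    and E: "is_onb E"
    and \<tau>: "((\<lambda>e. e \<bullet> B e) has_sum \<tau>) E"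
    and h: "((\<lambda>e. (norm (B e))\<^sup>2) has_sum h\<^sup>2) E" "h \<ge> 0"
    and t: "t \<ge> 0"
  shows "measure M {\<omega> \<in> space M. (norm (Y \<omega>))\<^sup>2 > \<tau> + 2 * sqrt t * h + 2 * t * onorm B} \<le> exp (- t)"
proof -
  interpret prob_space M by fact
  note on = is_onb_orthonormal[OF E]
  have bessel: "(\<Sum>g\<in>G. (x \<bullet> g)\<^sup>2) \<le> 1 * (norm x)\<^sup>2" if "orthonormal G" "finite G" for x :: 'b and G
    using orthonormal_Bessel[OF that] by simp
  have trace: "(\<Sum>g\<in>G. g \<bullet> B g) \<le> \<tau>" if "finite G" "orthonormal G" for G
    using positive_op_sum_le_trace[OF E B \<tau> that(1) bessel[OF that(2,1)]] by simp
  \<comment> \<open>Hilbert-Schmidt sums of B are trace sums of \<open>B o B\<close>, so the trace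
    comparison covers them as well.\<close>
  have B_sq: "e \<bullet> (B \<circ> B) e = (norm (B e))\<^sup>2" for e
    using B(2) by (simp add: self_adjoint_op_def power2_norm_eq_inner)
  have BB: "bounded_linear (B \<circ> B)" "self_adjoint_op (B \<circ> B)" "positive_op (B \<circ> B)"
  proof -
    show "bounded_linear (B \<circ> B)" using bounded_linear_compose[OF B(1,1)] by (simp add: o_def)
    show "self_adjoint_op (B \<circ> B)" using B(2) by (simp add: self_adjoint_op_def)
    show "positive_op (B \<circ> B)" unfolding positive_op_def B_sq by simp
  qed
  have hs: "(\<Sum>g\<in>G. (norm (B g))\<^sup>2) \<le> h\<^sup>2" if "finite G" "orthonormal G" for G
    using positive_op_sum_le_trace[OF E BB h(1)[folded B_sq] that(1) bessel[OF that(2,1)]]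
    unfolding B_sq by simp
  define c where "c = \<tau> + 2 * sqrt t * h + 2 * t * onorm B"
  define \<epsilon> where "\<epsilon> = (\<lambda>n. 2 * sqrt t * (1 / real (Suc n)))"
  define F where "F = (\<lambda>n. {e \<in> E. to_nat_on E e < n})"
  define S where "S = (\<lambda>n. {\<omega> \<in> space M. (\<Sum>f\<in>F n. (Y \<omega> \<bullet> f)\<^sup>2) > c + \<epsilon> n})"
  have F: "finite (F n)" "F n \<subseteq> E" for n
  proof -
    have "inj_on (to_nat_on E) (F n)"
      using inj_on_to_nat_on[OF orthonormal_countable[OF on]] by (rule inj_on_subset) (auto simp: F_def)
    moreover have "to_nat_on E ` F n \<subseteq> {..<n}" by (auto simp: F_def)
    ultimately show "finite (F n)" by (meson finite_lessThan finite_subset finite_image_iff)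
  qed (auto simp: F_def)
  note F_on = orthonormal_subset[OF on F(2)]
  have S_le: "measure M (S n) \<le> exp (- t)" for n
  proof -
    have "h\<^sup>2 \<le> (h + 1 / real (Suc n))\<^sup>2" using h(2) by (intro power_mono) auto
    with hs have hs': "(\<Sum>g\<in>G. (norm (B g))\<^sup>2) \<le> (h + 1 / real (Suc n))\<^sup>2"
      if "finite G" "orthonormal G" for G using that by (meson order_trans)
    have "h + 1 / real (Suc n) > 0" using h(2) by (intro add_nonneg_pos) auto
    from finite_orthonormal_tail_bound[OF \<open>prob_space M\<close> Y B sub F(1) F_on trace hs' this t]
    show ?thesis by (simp only: S_def c_def \<epsilon>_def distrib_left add.assoc add.commute add.left_commute)
  qed
  have "incseq S"
  proof (rule incseq_SucI, rule subsetI)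
    fix n \<omega> assume "\<omega> \<in> S n"
    moreover have "(\<Sum>f\<in>F n. (Y \<omega> \<bullet> f)\<^sup>2) \<le> (\<Sum>f\<in>F (Suc n). (Y \<omega> \<bullet> f)\<^sup>2)"
      by (intro sum_mono2 F) (auto simp: F_def)
    moreover have "\<epsilon> (Suc n) \<le> \<epsilon> n"
      unfolding \<epsilon>_def using t by (intro mult_left_mono divide_left_mono) auto
    ultimately show "\<omega> \<in> S (Suc n)" by (auto simp: S_def)
  qed
  moreover have "range S \<subseteq> sets M" by (auto simp: S_def)
  ultimately have "(\<lambda>n. measure M (S n)) \<longlonglongrightarrow> measure M (\<Union>n. S n)"
    by (intro finite_Lim_measure_incseq)
  then have "measure M (\<Union>n. S n) \<le> exp (- t)"
    by (rule LIMSEQ_le_const2) (use S_le in auto)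
  also have "(\<Union>n. S n) = {\<omega> \<in> space M. (norm (Y \<omega>))\<^sup>2 > c}"
  proof (intro equalityI subsetI)
    fix \<omega> assume "\<omega> \<in> (\<Union>n. S n)"
    then obtain n where n: "\<omega> \<in> space M" "c + \<epsilon> n < (\<Sum>f\<in>F n. (Y \<omega> \<bullet> f)\<^sup>2)" by (auto simp: S_def)
    moreover have "0 \<le> \<epsilon> n" using t by (simp add: \<epsilon>_def)
    ultimately show "\<omega> \<in> {\<omega> \<in> space M. (norm (Y \<omega>))\<^sup>2 > c}"
      using orthonormal_Bessel[OF F_on F(1), of "Y \<omega>" n] by auto
  next
    fix \<omega> assume \<omega>: "\<omega> \<in> {\<omega> \<in> space M. (norm (Y \<omega>))\<^sup>2 > c}"
    \<comment> \<open>One third of the excess pays for the finite approximation and one for the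
      slack; the last keeps the inequality strict.\<close>
    define \<delta> where "\<delta> = ((norm (Y \<omega>))\<^sup>2 - c) / 3"
    have \<delta>: "\<delta> > 0" using \<omega> by (simp add: \<delta>_def)
    obtain F0 where F0: "finite F0" "F0 \<subseteq> E" "dist (\<Sum>f\<in>F0. (Y \<omega> \<bullet> f)\<^sup>2) ((norm (Y \<omega>))\<^sup>2) \<le> \<delta>"
      using has_sum_finite_approximation[OF is_onb_Parseval[OF E] \<delta>] by blast
    obtain N1 where N1: "\<And>e. e \<in> F0 \<Longrightarrow> to_nat_on E e < N1"
      using F0(1) finite_nat_set_iff_bounded[of "to_nat_on E ` F0"] by auto
    obtain N2 where N2: "2 * sqrt t / \<delta> < real N2" using reals_Archimedean2 by blast
    define n where "n = max N1 N2"
    have "F0 \<subseteq> F n" using N1 F0(2) by (fastforce simp: F_def n_def)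
    then have "(\<Sum>f\<in>F0. (Y \<omega> \<bullet> f)\<^sup>2) \<le> (\<Sum>f\<in>F n. (Y \<omega> \<bullet> f)\<^sup>2)"
      by (intro sum_mono2 F) auto
    moreover have "\<epsilon> n < \<delta>"
    proof -
      have "2 * sqrt t / \<delta> < real (Suc n)" using N2 by (simp add: n_def)
      then show ?thesis using \<delta> by (simp add: \<epsilon>_def field_simps)
    qed
    moreover have "(norm (Y \<omega>))\<^sup>2 - \<delta> \<le> (\<Sum>f\<in>F0. (Y \<omega> \<bullet> f)\<^sup>2)"
      using F0(3) by (simp only: dist_real_def abs_le_iff) simp
    moreover have "(norm (Y \<omega>))\<^sup>2 = c + 3 * \<delta>" by (simp add: \<delta>_def field_simps)
    ultimately have "c + \<epsilon> n < (\<Sum>f\<in>F n. (Y \<omega> \<bullet> f)\<^sup>2)"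
      using \<delta> by linarith
    then show "\<omega> \<in> (\<Union>n. S n)" using \<omega> by (auto simp: S_def)
  qed
  finally show ?thesis by (simp add: c_def)
qed

theorem corollary2p6:
  fixes A :: "'a::{real_inner, banach, second_countable_topology} \<Rightarrow>
              'b::{real_inner, banach, second_countable_topology}"
    and R :: "'a \<Rightarrow> 'a"
    and B :: "'b \<Rightarrow> 'b"
    and M :: "'w measure"
    and X :: "'w \<Rightarrow> 'a"
  assumes "prob_space M"
    and "bounded_linear A"
    and "positive_op R" and "self_adjoint_op R" and "trace_class R"
    and "subgaussian M R X"
    and "B = A \<circ> R \<circ> adjoint A"
  shows "trace_class B \<and>
    (\<forall>t::real. t \<ge> 0 \<longrightarrow>
       measure M {\<omega> \<in> space M.
         (norm (A (X \<omega>)))\<^sup>2 > trace_op B + 2 * sqrt t * hs_norm B + 2 * t * onorm B}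
       \<le> exp (- t))"
proof -
  note A = \<open>bounded_linear A\<close>
  have R: "bounded_linear R" using assms(5) by (simp add: trace_class_def)
  have B_eq: "B y = A (R (adjoint A y))" for y by (simp add: assms(7))
  have adj: "A x \<bullet> y = x \<bullet> adjoint A y" "y \<bullet> A x = adjoint A y \<bullet> x" for x y
    using adjoint_inner[OF A, of x y] by (simp_all add: inner_commute)
  have B: "bounded_linear B" "self_adjoint_op B" "positive_op B"
  proof -
    show "bounded_linear B"
      unfolding B_eq[abs_def] by (intro bounded_linear_compose[OF A] bounded_linear_compose[OF R]
          bounded_linear_adjoint[OF A])
    show "self_adjoint_op B"
      using assms(4) by (simp add: self_adjoint_op_def B_eq adj)
    show "positive_op B"
      using assms(3) by (simp add: positive_op_def B_eq adj)
  qed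
  obtain P E' where "is_abs_op R P" "is_onb E'" "(\<lambda>e. e \<bullet> P e) summable_on E'"
    using assms(5) by (auto simp: trace_class_def)
  moreover from this have "P = R" using is_abs_op_positive_eq[OF R assms(4,3)] by simp
  ultimately have E': "is_onb E'" "((\<lambda>e. e \<bullet> R e) has_sum (\<Sum>\<^sub>\<infinity>e\<in>E'. e \<bullet> R e)) E'"
    by (auto intro: has_sum_infsum)
  define E :: "'b set" where "E = (SOME E. is_onb E)"
  have E: "is_onb E" unfolding E_def by (rule someI_ex[OF ex_is_onb])
  \<comment> \<open>The form of B at g is the form of R at \<open>adjoint A g\<close>. These vectors
    are no longer orthonormal, but they satisfy a Bessel inequality with constant
    \<open>(onorm A)^2\<close>.\<close>
  have B_sum: "(\<Sum>g\<in>G. g \<bullet> B g) \<le> (onorm A)\<^sup>2 * (\<Sum>\<^sub>\<infinity>e\<in>E'. e \<bullet> R e)"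
    if "finite G" "orthonormal G" for G
    unfolding B_eq adj
  proof (rule positive_op_sum_le_trace[OF E'(1) R assms(4,3) E'(2) that(1)])
    fix x
    have "(\<Sum>g\<in>G. (x \<bullet> adjoint A g)\<^sup>2) = (\<Sum>g\<in>G. (A x \<bullet> g)\<^sup>2)" by (simp add: adj)
    also have "\<dots> \<le> (norm (A x))\<^sup>2" by (rule orthonormal_Bessel[OF that(2,1)])
    also have "\<dots> \<le> (onorm A * norm x)\<^sup>2" by (intro power_mono onorm A) auto
    finally show "(\<Sum>g\<in>G. (x \<bullet> adjoint A g)\<^sup>2) \<le> (onorm A)\<^sup>2 * (norm x)\<^sup>2"
      by (simp add: power_mult_distrib)
  qed
  have pos: "0 \<le> e \<bullet> B e" for e using B(3) by (simp add: positive_op_def)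
  have summ: "(\<lambda>e. e \<bullet> B e) summable_on E"
    using B_sum orthonormal_subset[OF is_onb_orthonormal[OF E]] pos
    by (intro nonneg_bdd_above_summable_on bdd_aboveI2) auto
  then have trace: "((\<lambda>e. e \<bullet> B e) has_sum trace_op B) E"
    unfolding trace_op_def E_def[symmetric] by (rule has_sum_infsum)
  \<comment> \<open>Trace class implies Hilbert-Schmidt: each term is at most \<open>onorm B\<close>
    times the corresponding term of the trace.\<close>
  have summ2: "(\<lambda>e. (norm (B e))\<^sup>2) summable_on E"
    by (rule summable_on_comparison_test[OF summable_on_cmult_right[OF summ, of "onorm B"]])
       (use positive_op_norm_le[OF B] in auto)
  have "(hs_norm B)\<^sup>2 = (\<Sum>\<^sub>\<infinity>e\<in>E. (norm (B e))\<^sup>2)"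
    unfolding hs_norm_def E_def[symmetric] by (simp add: infsum_nonneg)
  then have hs: "((\<lambda>e. (norm (B e))\<^sup>2) has_sum (hs_norm B)\<^sup>2) E" using has_sum_infsum[OF summ2] by simp
  have "hs_norm B \<ge> 0" by (simp add: hs_norm_def infsum_nonneg)
  have "adjoint B = B" using B(2) by (intro adjoint_unique) (simp add: self_adjoint_op_def)
  then have "is_abs_op B B" using B by (simp add: is_abs_op_def)
  then have "trace_class B" using B(1) E summ unfolding trace_class_def by blast
  moreover have X[measurable]: "X \<in> borel_measurable M" using assms(6) by (simp add: subgaussian_def)
  have AX: "(\<lambda>\<omega>. A (X \<omega>)) \<in> borel_measurable M"
    using borel_measurable_continuous_onI[OF linear_continuous_on[OF A]] by measurable
  have "(\<integral>\<^sup>+\<omega>. ennreal (exp (w \<bullet> A (X \<omega>))) \<partial>M) \<le> ennreal (exp ((w \<bullet> B w) / 2))" for w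
    using subgaussian_nn_integral_exp_le[OF assms(6), of "adjoint A w"] by (simp add: adj B_eq)
  from orthonormal_basis_tail_bound[OF assms(1) AX B this E trace hs \<open>hs_norm B \<ge> 0\<close>]
  have "\<forall>t\<ge>0. measure M {\<omega> \<in> space M.
         (norm (A (X \<omega>)))\<^sup>2 > trace_op B + 2 * sqrt t * hs_norm B + 2 * t * onorm B} \<le> exp (- t)"
    by blast
  ultimately show ?thesis by blast
qed

end
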